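(* Let $P$, $w$, $\theta_p$, $\theta_w$, $X_{\underline{\theta}}$, $M_{\underline{\theta}}$ be as in the context. Assume that $w$ is minimum-phase (i.e. $\hat w$ has no zeros in the closed right half-plane) and that all poles and zeros of $P$ in the closed right half-plane have nonvanishing imaginary part. Let $\bar t>0$, let $\phi_-,\phi_+:[0,\bar t]\to\mathbb{R}$ be continuous with $\phi_-(t)<\phi_+(t)$ and $\phi_+(t)\ge0$ for all $t\in[0,\bar t]$, and put $$T=\{e\in C_0(\mathbb{R}_+)\mid\phi_-(t)\le e(t)\le\phi_+(t)\ \ \forall t\le\bar t\}.$$ Assume that there is $\bar e\in M_{\underline{\theta}}$ with $\phi_-(t)<\bar e(t)<\phi_+(t)$ for all $t\le\bar t$. If $\theta_w+\theta_p>1$, assume in addition that $w(0+)\ge0$. Then $$\mathrm{OS}^T_{\mathrm{opt}}:=\inf_{e\in T\cap M_{\underline{\theta}}}\ \sup_{t\ge0}(-e(t))_+=0.$$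
   Context: $\mathbb{R}_+=[0,\infty)$; $\hat g$ denotes the Laplace transform of $g$; $\lambda_+=\max(\lambda,0)$. $C_0(\mathbb{R}_+)$ is the space of continuous $\varphi:\mathbb{R}_+\to\mathbb{R}$ with $\lim_{t\to\infty}\varphi(t)=0$. Plant: $P$ is a proper real-rational function with a zero of order $\theta_p\ge 0$ at infinity (denominator degree minus numerator degree equals $\theta_p$). Reference input: $w:\mathbb{R}_+\to\mathbb{R}$ is an ordinary function (no delta terms) with rational Laplace transform $\hat w$ having a zero of order exactly $\theta_w\ge1$ at infinity. $P$ has poles $p_1,\dots,p_m$ and zeros $z_1,\dots,z_n$ in the closed right half-plane $\{\operatorname{Re}s\ge0\}$; none lie on the imaginary axis, and all are simple and mutually distinct. $X_{\underline{\theta}}$ is the set of $e\in C_0(\mathbb{R}_+)$ such that $\hat e$ is rational, $\hat e$ has a zero of order at least $\theta_w$ at infinity, and $\hat e-\hat w$ has a zero of order at least $\theta_p+\theta_w$ at infinity. Since here $\hat w$ has no zeros in the closed right half-plane, the feasible set of error signals is $$M_{\underline{\theta}}=\{e\in X_{\underline{\theta}}\mid\hat e(z_i)=\hat w(z_i)\ (i=1,\dots,n),\ \hat e(p_i)=0\ (i=1,\dots,m)\}.$$ *)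

theory Defs
  imports
    "HOL-Analysis.Analysis"
    "HOL-Computational_Algebra.Computational_Algebra"
    "HOL-Computational_Algebra.Field_as_Ring"
begin

text \<open>
  Rational functions are elements of \<^typ>\<open>'a poly fract\<close>; \<^const>\<open>quot_of_fract\<close> returns the
  representation in lowest terms with normalised denominator, so that the zeros and poles below
  are those left after cancellation.
\<close>

abbreviation rat_num :: "'a::field_gcd poly fract \<Rightarrow> 'a poly" where
  "rat_num q \<equiv> fst (quot_of_fract q)"

abbreviation rat_den :: "'a::field_gcd poly fract \<Rightarrow> 'a poly" where
  "rat_den q \<equiv> snd (quot_of_fract q)"

text \<open>The value is only meaningful away from the poles, where \<open>poly (rat_den q) z \<noteq> 0\<close>.\<close>

definition rat_eval :: "complex poly fract \<Rightarrow> complex \<Rightarrow> complex" where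
  "rat_eval q z = poly (rat_num q) z / poly (rat_den q) z"

definition zero_order_inf :: "'a::field_gcd poly fract \<Rightarrow> nat \<Rightarrow> bool" where
  "zero_order_inf q k \<longleftrightarrow> q \<noteq> 0 \<and> degree (rat_den q) = degree (rat_num q) + k"

text \<open>The zero function counts as having a zero of infinite order at infinity.\<close>

definition zero_order_inf_ge :: "'a::field_gcd poly fract \<Rightarrow> nat \<Rightarrow> bool" where
  "zero_order_inf_ge q k \<longleftrightarrow> q = 0 \<or> degree (rat_den q) \<ge> degree (rat_num q) + k"

abbreviation (input) cpoly :: "real poly \<Rightarrow> complex poly" where
  "cpoly p \<equiv> map_poly complex_of_real p"

definition crhp_zeros :: "real poly fract \<Rightarrow> complex set" where
  "crhp_zeros P = {z. Re z \<ge> 0 \<and> poly (cpoly (rat_num P)) z = 0}"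

definition crhp_poles :: "real poly fract \<Rightarrow> complex set" where
  "crhp_poles P = {p. Re p \<ge> 0 \<and> poly (cpoly (rat_den P)) p = 0}"

definition minimum_phase :: "complex poly fract \<Rightarrow> bool" where
  "minimum_phase G \<longleftrightarrow> (\<forall>s. Re s \<ge> 0 \<longrightarrow> poly (rat_num G) s \<noteq> 0)"

definition laplace :: "(real \<Rightarrow> real) \<Rightarrow> complex \<Rightarrow> complex" where
  "laplace g s = (LINT t:{0..}|lborel. exp (- s * complex_of_real t) * complex_of_real (g t))"

text \<open>
  The Laplace integral converges absolutely on some half-plane and agrees there with the
  rational function \<open>G\<close>. Outside that half-plane the transform means its continuation
  \<open>G\<close> (the reference \<open>w\<close> may be, for instance, a step, or unbounded).
\<close>

definition has_rational_laplace :: "(real \<Rightarrow> real) \<Rightarrow> complex poly fract \<Rightarrow> bool" where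
  "has_rational_laplace g G \<longleftrightarrow>
     (\<exists>\<sigma>::real. \<forall>s. Re s > \<sigma> \<longrightarrow>
        set_integrable lborel {0..}
          (\<lambda>t. exp (- s * complex_of_real t) * complex_of_real (g t)) \<and>
        laplace g s = rat_eval G s)"

text \<open>
  Functions on the half-line are total functions on \<^typ>\<open>real\<close> whose values at negative arguments
  are unconstrained and never used.
\<close>

definition C0_space :: "(real \<Rightarrow> real) set" where
  "C0_space = {f. continuous_on {0..} f \<and> (f \<longlongrightarrow> 0) at_top}"

text \<open>In the next two definitions \<open>W\<close> is the rational Laplace transform of the reference.\<close>

definition X_space :: "complex poly fract \<Rightarrow> nat \<Rightarrow> nat \<Rightarrow> (real \<Rightarrow> real) set" where
  "X_space W \<theta>w \<theta>p =
     {e \<in> C0_space. \<exists>E. has_rational_laplace e E \<and>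
        zero_order_inf_ge E \<theta>w \<and> zero_order_inf_ge (E - W) (\<theta>p + \<theta>w)}"

text \<open>
  The interpolation condition at a zero \<open>z\<close> of \<open>P\<close> presupposes that \<open>W\<close> is finite at \<open>z\<close>; this
  is spelled out because division by zero is total. No such clause is needed for \<open>E\<close>, which has
  no pole in the closed right half-plane since \<open>e\<close> vanishes at infinity.
\<close>

definition M_space ::
    "real poly fract \<Rightarrow> complex poly fract \<Rightarrow> nat \<Rightarrow> nat \<Rightarrow> (real \<Rightarrow> real) set" where
  "M_space P W \<theta>w \<theta>p =
     {e \<in> X_space W \<theta>w \<theta>p. \<exists>E. has_rational_laplace e E \<and>
        (\<forall>z\<in>crhp_zeros P. poly (rat_den W) z \<noteq> 0 \<and> rat_eval E z = rat_eval W z) \<and>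
        (\<forall>p\<in>crhp_poles P. rat_eval E p = 0)}"

definition T_space ::
    "(real \<Rightarrow> real) \<Rightarrow> (real \<Rightarrow> real) \<Rightarrow> real \<Rightarrow> (real \<Rightarrow> real) set" where
  "T_space \<phi>m \<phi>p tbar = {e \<in> C0_space. \<forall>t\<in>{0..tbar}. \<phi>m t \<le> e t \<and> e t \<le> \<phi>p t}"

definition OS :: "(real \<Rightarrow> real) \<Rightarrow> real" where
  "OS e = (SUP t\<in>{0..}. max (- e t) 0)"

end

theory Submission
  imports Defs
begin

text \<open>
  The overshoot is nonnegative, so the claim is that for every \<open>\<epsilon> > 0\<close> some feasible error signal in
  the template is at least \<open>- \<epsilon>\<close> at all times.  Such a signal is sought as \<open>ebar + d\<close>, where the
  correction \<open>d\<close> has a rational transform with a zero of order at least \<open>\<theta>p + \<theta>w\<close> at infinity that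
  vanishes at the poles and zeros \<open>s\<close> of \<open>P\<close> in the right half-plane.  With \<open>x = exp (- t)\<close>, every
  \<open>d = x (1 - x)\<^bsup>\<theta>p + \<theta>w - 1\<^esup> q(x)\<close>, \<open>q\<close> a real polynomial, has such a transform, with poles at
  negative integers, up to the vanishing at the points \<open>s\<close> (\<open>exp_poly_rational_transform\<close>).

  The admissible \<open>q\<close> form a convex set \<open>K\<close>, and the vanishing conditions are finitely many linear
  equations.  If they had no solution in \<open>K\<close>, a nontrivial combination of them would be nonnegative on
  \<open>K\<close> (\<open>convex_coordinates_separation\<close>).  This combination is the integral of \<open>d\<close> against a
  function \<open>h(t) = Re (\<Sum>s. c\<^sub>s exp (- s t))\<close>.  Since no \<open>s\<close> is real, \<open>h\<close> oscillates and
  is negative at arbitrarily late times (\<open>nonreal_exp_sum_negative\<close>).  But late positive bumps of any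
  height are allowed in \<open>d\<close>: after \<open>tbar\<close> only the lower bound \<open>- \<epsilon>\<close> is imposed.  Putting a high bump
  where \<open>h\<close> is negative makes the integral negative, a contradiction (\<open>exp_poly_correction\<close>).

  The bump is added to \<open>max (- ebar - \<epsilon> / 2) 0\<close>, which lifts \<open>ebar\<close> strictly inside the template
  because the upper bound is nonnegative, and the sum is approximated uniformly by corrections of the
  above form (\<open>exp_poly_approximation\<close>).  If \<open>\<theta>w + \<theta>p > 1\<close>, all corrections vanish at \<open>t = 0\<close>,
  so \<open>ebar 0 \<ge> 0\<close> is required; it holds as the initial value theorem gives \<open>ebar 0 = w(0+)\<close>
  (\<open>initial_value_order_two\<close>).
\<close>

section \<open>Rational functions in lowest terms\<close>

lemma quot_of_fract_cross:
  fixes a b :: "'a::field_gcd poly"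
  assumes "b \<noteq> 0"
  shows "a * rat_den (Fract a b) = b * rat_num (Fract a b)"
proof -
  have "Fract (rat_num (Fract a b)) (rat_den (Fract a b)) = Fract a b"
    by simp
  then show ?thesis
    using assms by (simp only: eq_fract snd_quot_of_fract_nonzero not_False_eq_True mult.commute)
qed

text \<open>
  The lowest-terms denominator divides every other denominator, so a representation that is regular
  at \<open>z\<close> decides regularity and the value there.
\<close>

lemma rat_den_Fract_nonzero:
  fixes a b :: "'a::field_gcd poly"
  assumes "poly b z \<noteq> 0"
  shows "poly (rat_den (Fract a b)) z \<noteq> 0"
proof -
  have "b \<noteq> 0" using assms by auto
  then have "rat_den (Fract a b) dvd b * rat_num (Fract a b)"
    by (metis quot_of_fract_cross dvd_triv_right)
  then have "rat_den (Fract a b) dvd b"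
    using coprime_quot_of_fract coprime_commute coprime_dvd_mult_left_iff by blast
  then show ?thesis
    using assms by (metis dvdE mult_zero_left poly_mult)
qed

lemma rat_eval_Fract:
  assumes "poly b z \<noteq> 0"
  shows "rat_eval (Fract a b) z = poly a z / poly b z"
proof -
  have "b \<noteq> 0" using assms by auto
  from arg_cong[OF quot_of_fract_cross[OF this, of a], of "\<lambda>p. poly p z"]
  show ?thesis
    using assms rat_den_Fract_nonzero[OF assms, of a]
    by (simp add: rat_eval_def field_simps)
qed

text \<open>
  The difference of the degrees of denominator and numerator does not change under cancellation.
\<close>

lemma zero_order_inf_ge_Fract:
  fixes a b :: "'a::field_gcd poly"
  assumes "b \<noteq> 0"
  shows "zero_order_inf_ge (Fract a b) k \<longleftrightarrow> a = 0 \<or> degree b \<ge> degree a + k"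
proof (cases "a = 0")
  case False
  then have nz: "Fract a b \<noteq> 0"
    using assms by (simp add: Zero_fract_def eq_fract)
  have "degree a + degree (rat_den (Fract a b)) = degree b + degree (rat_num (Fract a b))"
    using arg_cong[OF quot_of_fract_cross[OF assms, of a], of degree] False assms nz
    by (simp add: degree_mult_eq)
  with False nz show ?thesis
    by (auto simp: zero_order_inf_ge_def)
qed (simp add: zero_order_inf_ge_def Zero_fract_def[symmetric] fract_collapse)

lemma add_rat:
  fixes A B :: "'a::field_gcd poly fract"
  shows "A + B = Fract (rat_num A * rat_den B + rat_num B * rat_den A) (rat_den A * rat_den B)"
  using add_fract[of "rat_den A" "rat_den B" "rat_num A" "rat_num B"] by simp

lemma rat_den_add_nonzero:
  fixes A B :: "'a::field_gcd poly fract"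
  assumes "poly (rat_den A) z \<noteq> 0" "poly (rat_den B) z \<noteq> 0"
  shows "poly (rat_den (A + B)) z \<noteq> 0"
  using assms by (subst add_rat) (intro rat_den_Fract_nonzero, simp)

lemma rat_eval_add:
  assumes "poly (rat_den A) z \<noteq> 0" "poly (rat_den B) z \<noteq> 0"
  shows "rat_eval (A + B) z = rat_eval A z + rat_eval B z"
proof -
  have "rat_eval (A + B) z =
      poly (rat_num A * rat_den B + rat_num B * rat_den A) z / poly (rat_den A * rat_den B) z"
    using assms by (subst add_rat) (intro rat_eval_Fract, simp)
  then show ?thesis
    using assms by (simp add: rat_eval_def add_frac_eq)
qed

lemma uminus_rat:
  fixes A :: "'a::field_gcd poly fract"
  shows "- A = Fract (- rat_num A) (rat_den A)"
  using minus_fract[of "rat_num A" "rat_den A"] by simp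

lemma rat_den_uminus_nonzero:
  fixes A :: "'a::field_gcd poly fract"
  assumes "poly (rat_den A) z \<noteq> 0"
  shows "poly (rat_den (- A)) z \<noteq> 0"
  using assms by (subst uminus_rat) (rule rat_den_Fract_nonzero)

lemma rat_eval_uminus:
  assumes "poly (rat_den A) z \<noteq> 0"
  shows "rat_eval (- A) z = - rat_eval A z"
  using rat_eval_Fract[OF assms, of "- rat_num A"]
  by (simp add: uminus_rat[symmetric] rat_eval_def)

text \<open>
  If \<open>A\<close> has a pole at \<open>z\<close> then so has \<open>A + B\<close>, since subtracting the regular \<open>B\<close> cannot create
  one; the totalised value at a pole is \<open>0\<close>.  Hence adding a function that vanishes at \<open>z\<close> preserves
  \<open>rat_eval A z = 0\<close> under either reading of that equation.
\<close>

lemma rat_eval_add_zero: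
  assumes B: "poly (rat_den B) z \<noteq> 0" "rat_eval B z = 0" and A: "rat_eval A z = 0"
  shows "rat_eval (A + B) z = 0"
proof (cases "poly (rat_den A) z = 0")
  case True
  have "poly (rat_den (A + B)) z = 0"
  proof (rule ccontr)
    assume "poly (rat_den (A + B)) z \<noteq> 0"
    then have "poly (rat_den ((A + B) + (- B))) z \<noteq> 0"
      by (rule rat_den_add_nonzero) (rule rat_den_uminus_nonzero, rule B)
    moreover have "A + B + - B = A" by simp
    ultimately show False using True by metis
  qed
  then show ?thesis by (simp add: rat_eval_def)
qed (use assms rat_eval_add in simp)

lemma zero_order_inf_ge_add:
  fixes A B :: "'a::field_gcd poly fract"
  assumes "zero_order_inf_ge A k" "zero_order_inf_ge B k"
  shows "zero_order_inf_ge (A + B) k"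
proof (cases "A = 0 \<or> B = 0")
  case False
  let ?n = "rat_num A * rat_den B + rat_num B * rat_den A"
  have "degree (rat_num A * rat_den B) + k \<le> degree (rat_den A) + degree (rat_den B)"
       "degree (rat_num B * rat_den A) + k \<le> degree (rat_den A) + degree (rat_den B)"
    using assms False by (simp_all add: zero_order_inf_ge_def degree_mult_eq)
  then have "degree ?n + k \<le> degree (rat_den A * rat_den B)"
    using degree_add_le_max[of "rat_num A * rat_den B" "rat_num B * rat_den A"]
    by (simp add: degree_mult_eq)
  then show ?thesis
    by (subst add_rat) (simp add: zero_order_inf_ge_Fract)
qed (use assms in auto)

lemma zero_order_inf_ge_mono:
  "zero_order_inf_ge A k \<Longrightarrow> l \<le> k \<Longrightarrow> zero_order_inf_ge A l"
  by (auto simp: zero_order_inf_ge_def)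

text \<open>
  Additivity of \<open>rat_eval\<close> fails at poles, so transforms are added on a half-plane to the right of
  all of them.
\<close>

lemma eventually_rat_den_nonzero:
  "\<exists>b. \<forall>s. Re s > b \<longrightarrow> poly (rat_den (A :: complex poly fract)) s \<noteq> 0"
proof -
  have fin: "finite (Re ` {s. poly (rat_den A) s = 0})"
    by (intro finite_imageI poly_roots_finite) simp
  then obtain b where "\<forall>x \<in> Re ` {s. poly (rat_den A) s = 0}. x \<le> b"
    by (metis bdd_above_finite bdd_above_def)
  then show ?thesis by (intro exI[of _ b]) force
qed

lemma rat_eval_order_two_tendsto_0:
  assumes "zero_order_inf_ge F 2"
  shows "((\<lambda>x. complex_of_real x * rat_eval F (complex_of_real x)) \<longlongrightarrow> 0) at_top"
proof (cases "F = 0")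
  case False
  have "degree (pCons 0 (rat_num F)) < degree (rat_den F)"
    using assms False by (simp add: zero_order_inf_ge_def)
  then have "((\<lambda>s. poly (pCons 0 (rat_num F)) s / poly (rat_den F) s) \<longlongrightarrow> 0) at_infinity"
    by (rule poly_divide_tendsto_0_at_infinity)
  moreover have "filterlim complex_of_real at_infinity at_top"
    by (rule filterlim_of_real_at_infinity)
  ultimately have "((\<lambda>x. poly (pCons 0 (rat_num F)) (complex_of_real x) / poly (rat_den F) (complex_of_real x)) \<longlongrightarrow> 0) at_top"
    by (rule filterlim_compose)
  then show ?thesis by (simp add: rat_eval_def)
qed (simp add: rat_eval_def)

section \<open>Laplace transforms on a half-plane\<close>

definition laplace_integrable :: "(real \<Rightarrow> real) \<Rightarrow> complex \<Rightarrow> bool" where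
  "laplace_integrable f s \<longleftrightarrow>
     set_integrable lborel {0..} (\<lambda>t. exp (- s * complex_of_real t) * complex_of_real (f t))"

lemma exp_decay_integral:
  fixes a :: real
  assumes "a > 0"
  shows "set_integrable lborel {0..} (\<lambda>t. exp (- a * t))"
    and "(LINT t:{0..}|lborel. exp (- a * t)) = 1 / a"
proof -
  have lim: "((\<lambda>t. - exp (- a * t) / a) \<longlongrightarrow> 0) at_top"
    using assms by real_asymp
  have "(\<integral>\<^sup>+ t. ennreal (exp (- a * t)) * indicator {0..} t \<partial>lborel) = ennreal (0 - (- exp (- a * 0) / a))"
    using assms by (intro nn_integral_FTC_atLeast lim)
      (auto intro!: derivative_eq_intros simp: field_simps)
  moreover have "(\<integral>\<^sup>+ t. ennreal (indicator {0..} t *\<^sub>R exp (- a * t)) \<partial>lborel) =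
      (\<integral>\<^sup>+ t. ennreal (exp (- a * t)) * indicator {0..} t \<partial>lborel)"
    by (intro nn_integral_cong) (simp split: split_indicator)
  ultimately have nn: "(\<integral>\<^sup>+ t. ennreal (indicator {0..} t *\<^sub>R exp (- a * t)) \<partial>lborel) = ennreal (1 / a)"
    by simp
  have "has_bochner_integral lborel (\<lambda>t. indicator {0..} t *\<^sub>R exp (- a * t)) (1 / a)"
    using assms by (intro has_bochner_integral_nn_integral[OF _ _ _ nn]) auto
  then show "set_integrable lborel {0..} (\<lambda>t. exp (- a * t))"
    and "(LINT t:{0..}|lborel. exp (- a * t)) = 1 / a"
    unfolding set_integrable_def set_lebesgue_integral_def
    by (simp_all add: has_bochner_integral_iff)
qed

lemma laplace_bounded:
  assumes cont: "continuous_on {0..} f" and bd: "\<And>t. t \<ge> 0 \<Longrightarrow> \<bar>f t\<bar> \<le> B" and s: "Re s > 0"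
  shows "laplace_integrable f s" and "norm (laplace f s) \<le> B / Re s"
proof -
  let ?k = "\<lambda>t. exp (- s * complex_of_real t) * complex_of_real (f t)"
  have kB: "norm (?k t) \<le> B * exp (- Re s * t)" if "t \<ge> 0" for t
    using bd[OF that] by (simp add: norm_mult mult.commute mult_left_mono)
  have int: "set_integrable lborel {0..} (\<lambda>t. B * exp (- Re s * t))"
    using exp_decay_integral(1)[OF s] by simp
  have "set_borel_measurable lborel {0..} ?k"
    unfolding set_borel_measurable_def
    by (subst measurable_lborel2, rule borel_measurable_continuous_on_indicator)
       (auto intro!: continuous_intros cont)
  then have *: "set_integrable lborel {0..} ?k"
    by (rule set_integrable_bound[OF int]) (use kB in \<open>auto intro!: AE_I2 intro: order_trans[OF _ abs_ge_self]\<close>)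
  then show "laplace_integrable f s"
    by (simp add: laplace_integrable_def)
  have "norm (laplace f s) \<le> (LINT t:{0..}|lborel. norm (?k t))"
    unfolding laplace_def by (rule set_integral_norm_bound[OF *])
  also have "\<dots> \<le> (LINT t:{0..}|lborel. B * exp (- Re s * t))"
    by (intro set_integral_mono set_integrable_norm * int) (use kB in auto)
  also have "\<dots> = B / Re s"
    using exp_decay_integral(2)[OF s] by simp
  finally show "norm (laplace f s) \<le> B / Re s" .
qed

lemma laplace_add:
  assumes "laplace_integrable f s" "laplace_integrable g s"
  shows "laplace_integrable (\<lambda>t. f t + g t) s"
    and "laplace (\<lambda>t. f t + g t) s = laplace f s + laplace g s"
  using set_integral_add[OF assms[unfolded laplace_integrable_def]]
  by (simp_all add: laplace_integrable_def laplace_def distrib_left)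

lemma laplace_cmult:
  assumes "laplace_integrable f s"
  shows "laplace_integrable (\<lambda>t. a * f t) s"
    and "laplace (\<lambda>t. a * f t) s = complex_of_real a * laplace f s"
proof -
  have eq: "exp (- s * complex_of_real t) * complex_of_real (a * f t) =
      complex_of_real a * (exp (- s * complex_of_real t) * complex_of_real (f t))" for t
    by simp
  show "laplace_integrable (\<lambda>t. a * f t) s"
    unfolding laplace_integrable_def eq
    using assms[unfolded laplace_integrable_def] by (rule set_integrable_mult_right)
  show "laplace (\<lambda>t. a * f t) s = complex_of_real a * laplace f s"
    unfolding laplace_def eq by simp
qed

lemma laplace_diff:
  assumes "laplace_integrable f s" "laplace_integrable g s"
  shows "laplace_integrable (\<lambda>t. f t - g t) s"
    and "laplace (\<lambda>t. f t - g t) s = laplace f s - laplace g s"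
  using set_integral_diff[OF assms[unfolded laplace_integrable_def]]
  by (simp_all add: laplace_integrable_def laplace_def right_diff_distrib)

text \<open>
  The only complex integral that has to be evaluated; all other transforms follow from it by
  shifting \<open>s\<close> and by linearity.
\<close>

lemma laplace_const_one:
  assumes s: "Re s > 0"
  shows "laplace (\<lambda>t. 1) s = 1 / s"
proof -
  have s0: "s \<noteq> 0" using s by auto
  have int: "set_integrable lborel {0..} (\<lambda>t. exp (- s * complex_of_real t))"
    using laplace_bounded(1)[of "\<lambda>t. 1" 1 s] s by (simp add: laplace_integrable_def)
  have lim: "((\<lambda>t. - exp (- s * complex_of_real t) / s) \<longlongrightarrow> 0) at_top"
  proof (rule tendsto_norm_zero_cancel)
    have "((\<lambda>t. exp (- Re s * t) / cmod s) \<longlongrightarrow> 0) at_top"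
      using s s0 by real_asymp
    then show "((\<lambda>t. norm (- exp (- s * complex_of_real t) / s)) \<longlongrightarrow> 0) at_top"
      by (simp add: norm_divide)
  qed
  have "(LBINT t=ereal 0..\<infinity>. exp (- s * complex_of_real t)) = 0 - (- exp (- s * complex_of_real 0) / s)"
  proof (rule interval_integral_FTC_integrable)
    show "((\<lambda>t. - exp (- s * complex_of_real t) / s) has_vector_derivative exp (- s * complex_of_real x)) (at x)" for x
      using s0 by (auto intro!: derivative_eq_intros has_vector_derivative_real_field simp: field_simps)
    show "isCont (\<lambda>t. exp (- s * complex_of_real t)) x" for x
      by (intro continuous_intros)
    show "set_integrable lborel (einterval (ereal 0) \<infinity>) (\<lambda>t. exp (- s * complex_of_real t))"
      by (rule set_integrable_subset[OF int]) (auto simp: einterval_def)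
    show "(((\<lambda>t. - exp (- s * complex_of_real t) / s) \<circ> real_of_ereal) \<longlongrightarrow> 0) (at_left \<infinity>)"
      using lim by (simp add: ereal_tendsto_simps)
    have "((\<lambda>t. - exp (- s * complex_of_real t) / s) \<longlongrightarrow> - exp (- s * complex_of_real 0) / s) (at_right 0)"
      by (intro tendsto_intros s0)
    then show "(((\<lambda>t. - exp (- s * complex_of_real t) / s) \<circ> real_of_ereal) \<longlongrightarrow> - exp (- s * complex_of_real 0) / s) (at_right (ereal 0))"
      by (simp add: ereal_tendsto_simps)
  qed simp
  moreover have "(LINT t:{0..}|lborel. exp (- s * complex_of_real t)) = (LINT t:{0<..}|lborel. exp (- s * complex_of_real t))"
    by (rule set_integral_discrete_difference[of "{0::real}"]) auto
  ultimately show ?thesis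
    by (simp add: laplace_def interval_integral_to_infinity_eq)
qed

lemma laplace_shift:
  "laplace (\<lambda>t. exp (- c * t) * f t) s = laplace f (s + complex_of_real c)"
proof -
  have "exp (- s * complex_of_real t) * complex_of_real (exp (- c * t) * f t) =
      exp (- (s + complex_of_real c) * complex_of_real t) * complex_of_real (f t)" for t
  proof -
    have "complex_of_real (exp (- c * t)) = exp (- complex_of_real c * complex_of_real t)"
      by (metis exp_of_real of_real_minus of_real_mult)
    moreover have "- (s + complex_of_real c) * complex_of_real t =
        - s * complex_of_real t + - complex_of_real c * complex_of_real t"
      by (simp add: algebra_simps)
    ultimately show ?thesis
      by (simp only: exp_add of_real_mult mult.assoc)
  qed
  then show ?thesis by (simp only: laplace_def)
qed

text \<open>
  With \<open>x = exp (- t)\<close> the integral is Euler's Beta integral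
  \<open>\<integral>\<^sub>0\<^sup>1 x\<^bsup>s + j\<^esup> (1 - x)\<^sup>m dx\<close>.  The induction step writes
  \<open>(1 - x)\<^bsup>m + 1\<^esup> = (1 - x)\<^sup>m - x (1 - x)\<^sup>m\<close>, so the value for \<open>m + 1\<close> is the difference of the
  values for \<open>(j, m)\<close> and \<open>(j + 1, m)\<close>.  What matters is that the numerator is constant: the factor
  \<open>(1 - x)\<^sup>m\<close> in time produces a zero of order \<open>m + 1\<close> at infinity in frequency.
\<close>

lemma laplace_beta:
  assumes s: "Re s > 0"
  shows "laplace (\<lambda>t. exp (- t) ^ Suc j * (1 - exp (- t)) ^ m) s =
    fact m / (\<Prod>i\<le>m. s + of_nat (Suc j + i))"
proof (induction m arbitrary: j)
  case 0
  have "laplace (\<lambda>t. exp (- t) ^ Suc j) s = laplace (\<lambda>t. exp (- real (Suc j) * t) * 1) s"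
    by (rule arg_cong[where f = "\<lambda>f. laplace f s"], rule ext)
       (simp add: exp_of_nat_mult[symmetric] del: of_nat_Suc power_Suc)
  also have "\<dots> = 1 / (s + of_nat (Suc j))"
    using s by (subst laplace_shift, subst laplace_const_one) auto
  finally show ?case by simp
next
  case (Suc m)
  let ?g = "\<lambda>j t. exp (- t) ^ Suc j * (1 - exp (- t)) ^ m :: real"
  have int: "laplace_integrable (?g j) s" for j
  proof (rule laplace_bounded(1)[OF _ _ s, where B = 1])
    show "\<bar>?g j t\<bar> \<le> 1" if "t \<ge> 0" for t
      using that by (simp add: abs_mult mult_le_one power_le_one del: power_Suc)
  qed (intro continuous_intros)
  \<comment> \<open>the factors common to the two products\<close>
  define Q where "Q = (\<Prod>i\<in>{1..m}. s + of_nat (Suc j + i))"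
  have nz: "s + of_nat k \<noteq> 0" for k
    using s by (auto simp: complex_eq_iff)
  have Q0: "Q \<noteq> 0"
    unfolding Q_def using nz by (auto simp del: of_nat_Suc of_nat_add)
  have "laplace (\<lambda>t. exp (- t) ^ Suc j * (1 - exp (- t)) ^ Suc m) s =
      laplace (\<lambda>t. ?g j t - ?g (Suc j) t) s"
    by (rule arg_cong[where f = "\<lambda>f. laplace f s"]) (auto simp: algebra_simps)
  also have "\<dots> = laplace (?g j) s - laplace (?g (Suc j)) s"
    by (rule laplace_diff(2)[OF int int])
  also have "\<dots> = fact m / (\<Prod>i\<le>m. s + of_nat (Suc j + i)) - fact m / (\<Prod>i\<le>m. s + of_nat (Suc (Suc j) + i))"
    by (simp only: Suc.IH)
  also have "(\<Prod>i\<le>m. s + of_nat (Suc j + i)) = (s + of_nat (Suc j)) * Q"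
    unfolding Q_def by (simp add: atMost_atLeast0 prod.atLeast_Suc_atMost)
  also have "(\<Prod>i\<le>m. s + of_nat (Suc (Suc j) + i)) = (\<Prod>i\<in>{1..Suc m}. s + of_nat (Suc j + i))"
    using prod.shift_bounds_cl_Suc_ivl[of "\<lambda>i. s + of_nat (Suc j + i)" 0 m]
    by (simp add: atMost_atLeast0)
  also have "\<dots> = Q * (s + of_nat (Suc j + Suc m))"
    unfolding Q_def by (simp add: mult.commute)
  also have "fact m / ((s + of_nat (Suc j)) * Q) - fact m / (Q * (s + of_nat (Suc j + Suc m))) =
      fact (Suc m) / ((s + of_nat (Suc j)) * (Q * (s + of_nat (Suc j + Suc m))))"
    using Q0 nz[of "Suc j"] nz[of "Suc j + Suc m"]
    by (simp add: divide_simps) (simp add: algebra_simps)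
  also have "(s + of_nat (Suc j)) * (Q * (s + of_nat (Suc j + Suc m))) = (\<Prod>i\<le>Suc m. s + of_nat (Suc j + i))"
    unfolding Q_def by (simp add: atMost_atLeast0 prod.atLeast_Suc_atMost mult.commute)
  finally show ?case .
qed

text \<open>
  The kernel \<open>x exp (- x t)\<close> has mass \<open>1\<close> and concentrates at \<open>t = 0\<close> as \<open>x\<close> grows.  For
  \<open>g = f - l\<close> the part of the integral near \<open>0\<close> is at most the local bound \<open>k\<close> of \<open>\<bar>g\<bar>\<close>; beyond \<open>d\<close>
  the integrand loses a factor \<open>exp (- (x - b) d)\<close> against the absolutely integrable one at
  abscissa \<open>b\<close>.
\<close>

lemma initial_value_theorem:
  assumes lim: "(f \<longlongrightarrow> l) (at_right 0)"
    and int: "\<And>s. Re s > \<sigma> \<Longrightarrow> laplace_integrable f s"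
  shows "((\<lambda>x. complex_of_real x * laplace f (complex_of_real x)) \<longlongrightarrow> complex_of_real l) at_top"
proof -
  define b where "b = max \<sigma> 0 + 1"
  have b: "b > \<sigma>" "b > 0" by (auto simp: b_def)
  define g where "g = (\<lambda>t. f t - l)"
  have int_const: "laplace_integrable (\<lambda>t. l) s" "laplace (\<lambda>t. l) s = l / s" if "Re s > 0" for s
    using laplace_cmult[OF laplace_bounded(1)[of "\<lambda>t. 1" 1 s], of l] that laplace_const_one[OF that]
    by simp_all
  have int_g: "laplace_integrable g (complex_of_real x)" if "x \<ge> b" for x
    unfolding g_def by (rule laplace_diff(1)[OF int int_const(1)]) (use that b in auto)
  have lap_g: "laplace g (complex_of_real x) = laplace f (complex_of_real x) - l / x" if "x \<ge> b" for x
    unfolding g_def using that b by (subst laplace_diff(2)[OF int int_const(1)]) (auto simp: int_const(2))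
  define C where "C = (LINT t:{0..}|lborel. norm (exp (- complex_of_real b * complex_of_real t) * complex_of_real (g t)))"
  have g0: "(g \<longlongrightarrow> 0) (at_right 0)"
    unfolding g_def using tendsto_diff[OF lim tendsto_const[of l]] by simp
  have "((\<lambda>x. complex_of_real x * laplace g (complex_of_real x)) \<longlongrightarrow> 0) at_top"
  proof (rule tendstoI)
    fix e :: real assume e: "e > 0"
    define k where "k = e / 2"
    have k: "k > 0" "k < e" using e by (auto simp: k_def)
    from tendstoD[OF g0 k(1)] obtain d where d: "d > 0" "\<And>t. 0 < t \<Longrightarrow> t < d \<Longrightarrow> \<bar>g t\<bar> < k"
      unfolding eventually_at_right_field by auto
    have bound: "norm (complex_of_real x * laplace g (complex_of_real x)) \<le> k + x * exp (- (x - b) * d) * C"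
      if x: "x \<ge> b" for x
    proof -
      let ?G = "\<lambda>x t. norm (exp (- complex_of_real x * complex_of_real t) * complex_of_real (g t))"
      have G: "?G x t = exp (- x * t) * \<bar>g t\<bar>" for x t
        by (simp add: norm_mult)
      have iG: "set_integrable lborel {0..} (?G x)" if "x \<ge> b" for x
        by (rule set_integrable_norm[OF int_g[OF that, unfolded laplace_integrable_def]])
      have ik: "set_integrable lborel {0..} (\<lambda>t. k * exp (- x * t))"
        using exp_decay_integral(1)[of x] x b by simp
      have "norm (laplace g (complex_of_real x)) \<le> (LINT t:{0..}|lborel. ?G x t)"
        unfolding laplace_def by (rule set_integral_norm_bound[OF int_g[OF x, unfolded laplace_integrable_def]])
      also have "\<dots> \<le> (LINT t:{0..}|lborel. k * exp (- x * t) + exp (- (x - b) * d) * ?G b t)"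
      proof (rule set_integral_mono_AE)
        show "set_integrable lborel {0..} (\<lambda>t. k * exp (- x * t) + exp (- (x - b) * d) * ?G b t)"
          using ik iG[of b] by (intro set_integral_add(1) set_integrable_mult_right) auto
        have "?G x t \<le> k * exp (- x * t) + exp (- (x - b) * d) * ?G b t" if t: "t > 0" for t
        proof (cases "t < d")
          case True
          have "exp (- x * t) * \<bar>g t\<bar> \<le> exp (- x * t) * k"
            using d(2)[OF t True] by (intro mult_left_mono) auto
          then show ?thesis
            unfolding G by (simp add: mult.commute add_increasing2)
        next
          case False
          have "exp (- x * t) = exp (- (x - b) * t) * exp (- b * t)"
            by (simp add: exp_add[symmetric] algebra_simps)
          also have "\<dots> \<le> exp (- (x - b) * d) * exp (- b * t)"
            using mult_left_mono[of d t "x - b"] False x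
            by (intro mult_right_mono) (simp_all add: algebra_simps)
          finally have "exp (- x * t) * \<bar>g t\<bar> \<le> exp (- (x - b) * d) * exp (- b * t) * \<bar>g t\<bar>"
            by (rule mult_right_mono) simp
          then show ?thesis
            unfolding G using k(1) by (simp add: mult.assoc add_increasing)
        qed
        moreover have "AE t in lborel. t \<noteq> (0::real)"
          by (rule AE_lborel_singleton)
        ultimately show "AE t\<in>{0..} in lborel. ?G x t \<le> k * exp (- x * t) + exp (- (x - b) * d) * ?G b t"
          by (auto elim!: eventually_mono)
      qed (use iG[OF x] in auto)
      also have "\<dots> = k / x + exp (- (x - b) * d) * C"
        using ik iG[of b] exp_decay_integral[of x] x b
        by (subst set_integral_add(2)) (auto simp: C_def)
      finally have "x * norm (laplace g (complex_of_real x)) \<le> x * (k / x + exp (- (x - b) * d) * C)"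
        using x b by (intro mult_left_mono) auto
      then show ?thesis
        using x b by (simp add: norm_mult algebra_simps)
    qed
    have "((\<lambda>x. k + x * exp (- (x - b) * d) * C) \<longlongrightarrow> k) at_top"
      using d(1) by real_asymp
    from order_tendstoD(2)[OF this k(2)] eventually_ge_at_top[of b]
    show "\<forall>\<^sub>F x in at_top. dist (complex_of_real x * laplace g (complex_of_real x)) 0 < e"
      by eventually_elim (use bound in \<open>fastforce intro: le_less_trans\<close>)
  qed
  then have "((\<lambda>x. complex_of_real x * laplace g (complex_of_real x) + l) \<longlongrightarrow> 0 + complex_of_real l) at_top"
    by (intro tendsto_intros)
  moreover have "\<forall>\<^sub>F x in at_top. complex_of_real x * laplace g (complex_of_real x) + l =
      complex_of_real x * laplace f (complex_of_real x)"
    using eventually_ge_at_top[of b] by eventually_elim (use b in \<open>auto simp: lap_g field_simps\<close>)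
  ultimately show ?thesis
    by (simp add: filterlim_cong[OF refl refl])
qed

section \<open>Exponential polynomials and their transforms\<close>

text \<open>
  The corrections added to an error signal.  Substituting \<open>x = exp (- t)\<close> turns the half-line into
  \<open>(0, 1]\<close> and the correction into \<open>x (1 - x)\<^sup>m q(x)\<close>: the factor \<open>x\<close> gives decay at infinity, the
  factor \<open>(1 - x)\<^sup>m\<close> the zero of order \<open>m + 1\<close> of the transform, and \<open>q\<close> leaves enough freedom
  for the Weierstrass theorem.
\<close>

definition exp_poly :: "nat \<Rightarrow> real poly \<Rightarrow> real \<Rightarrow> real" where
  "exp_poly m q t = exp (- t) * (1 - exp (- t)) ^ m * poly q (exp (- t))"

lemma rational_transform_beta_sum:
  fixes a :: "nat \<Rightarrow> real"
  shows "\<exists>D. zero_order_inf_ge D (Suc m) \<and>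
    (\<forall>s. Re s > 0 \<longrightarrow> poly (rat_den D) s \<noteq> 0 \<and>
      laplace_integrable (\<lambda>t. \<Sum>j<n. a j * (exp (- t) ^ Suc j * (1 - exp (- t)) ^ m)) s \<and>
      laplace (\<lambda>t. \<Sum>j<n. a j * (exp (- t) ^ Suc j * (1 - exp (- t)) ^ m)) s = rat_eval D s)"
proof (induction n)
  case 0
  show ?case
    by (intro exI[of _ 0]) (simp add: zero_order_inf_ge_def rat_eval_def laplace_def laplace_integrable_def set_integrable_def)
next
  case (Suc n)
  then obtain D where D: "zero_order_inf_ge D (Suc m)"
    "\<And>s. Re s > 0 \<Longrightarrow> poly (rat_den D) s \<noteq> 0"
    "\<And>s. Re s > 0 \<Longrightarrow> laplace_integrable (\<lambda>t. \<Sum>j<n. a j * (exp (- t) ^ Suc j * (1 - exp (- t)) ^ m)) s"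
    "\<And>s. Re s > 0 \<Longrightarrow> laplace (\<lambda>t. \<Sum>j<n. a j * (exp (- t) ^ Suc j * (1 - exp (- t)) ^ m)) s = rat_eval D s"
    by blast
  define d :: "complex poly" where "d = (\<Prod>i\<le>m. [: of_nat (Suc n + i), 1 :])"
  define B where "B = Fract [: complex_of_real (a n) * fact m :] d"
  have poly_d: "poly d s = (\<Prod>i\<le>m. s + of_nat (Suc n + i))" for s
    by (simp add: d_def poly_prod add.commute del: of_nat_Suc of_nat_add)
  have d0: "d \<noteq> 0" by (simp add: d_def)
  have deg_d: "degree d = Suc m"
    unfolding d_def by (subst degree_prod_eq_sum_degree) auto
  have pd: "poly d s \<noteq> 0" if "Re s > 0" for s
  proof -
    have "s + of_nat (Suc n + i) \<noteq> 0" for i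
      using that by (auto simp: complex_eq_iff)
    then show ?thesis by (simp add: poly_d del: of_nat_Suc of_nat_add)
  qed
  have Bk: "zero_order_inf_ge B (Suc m)"
    unfolding B_def using d0 by (subst zero_order_inf_ge_Fract) (auto simp: deg_d)
  have B_den: "poly (rat_den B) s \<noteq> 0" if "Re s > 0" for s
    unfolding B_def by (rule rat_den_Fract_nonzero[OF pd[OF that]])
  have B_eval: "rat_eval B s = a n * laplace (\<lambda>t. exp (- t) ^ Suc n * (1 - exp (- t)) ^ m) s"
    if "Re s > 0" for s
    unfolding B_def rat_eval_Fract[OF pd[OF that]] laplace_beta[OF that] poly_d by simp
  have B_int: "laplace_integrable (\<lambda>t. exp (- t) ^ Suc n * (1 - exp (- t)) ^ m) s" if "Re s > 0" for s
  proof (rule laplace_bounded(1)[OF _ _ that, where B = 1])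
    show "\<bar>exp (- t) ^ Suc n * (1 - exp (- t)) ^ m\<bar> \<le> 1" if "t \<ge> 0" for t :: real
      using that by (simp add: abs_mult mult_le_one power_le_one del: power_Suc)
  qed (intro continuous_intros)
  show ?case
  proof (intro exI[of _ "D + B"] conjI allI impI)
    show "zero_order_inf_ge (D + B) (Suc m)"
      by (rule zero_order_inf_ge_add[OF D(1) Bk])
    fix s :: complex assume s: "Re s > 0"
    show "poly (rat_den (D + B)) s \<noteq> 0"
      by (rule rat_den_add_nonzero[OF D(2)[OF s] B_den[OF s]])
    note add = laplace_add[OF D(3)[OF s] laplace_cmult(1)[OF B_int[OF s], of "a n"]]
    show "laplace_integrable (\<lambda>t. \<Sum>j<Suc n. a j * (exp (- t) ^ Suc j * (1 - exp (- t)) ^ m)) s"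
      using add(1) by (simp only: sum.lessThan_Suc)
    show "laplace (\<lambda>t. \<Sum>j<Suc n. a j * (exp (- t) ^ Suc j * (1 - exp (- t)) ^ m)) s = rat_eval (D + B) s"
      using add(2) by (simp only: sum.lessThan_Suc D(4)[OF s] laplace_cmult(2)[OF B_int[OF s]]
        rat_eval_add[OF D(2)[OF s] B_den[OF s]] B_eval[OF s])
  qed
qed

lemma exp_poly_rational_transform:
  obtains D where "zero_order_inf_ge D (Suc m)"
    and "\<And>s. Re s > 0 \<Longrightarrow> poly (rat_den D) s \<noteq> 0"
    and "\<And>s. Re s > 0 \<Longrightarrow> laplace_integrable (exp_poly m q) s"
    and "\<And>s. Re s > 0 \<Longrightarrow> laplace (exp_poly m q) s = rat_eval D s"
proof -
  have eq: "exp_poly m q = (\<lambda>t. \<Sum>j<Suc (degree q). coeff q j * (exp (- t) ^ Suc j * (1 - exp (- t)) ^ m))"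
    by (rule ext) (simp add: exp_poly_def poly_altdef sum_distrib_left lessThan_Suc_atMost mult_ac)
  from rational_transform_beta_sum[where n = "Suc (degree q)" and a = "coeff q" and m = m]
  obtain D where "zero_order_inf_ge D (Suc m)"
    and "\<forall>s. Re s > 0 \<longrightarrow> poly (rat_den D) s \<noteq> 0 \<and>
      laplace_integrable (exp_poly m q) s \<and> laplace (exp_poly m q) s = rat_eval D s"
    unfolding eq[symmetric] by (elim exE conjE)
  then show thesis
    by (intro that) auto
qed

section \<open>Sign changes of exponential sums\<close>

text \<open>
  Advancing by half a period of the mode \<open>r\<close> multiplies it by a negative real number.  Hence
  \<open>h(t) + exp (Re r \<pi> / Im r) h(t + \<pi> / Im r)\<close> removes this mode from an exponential sum \<open>h\<close>, and
  its weights are positive, so nonnegativity of \<open>h\<close> survives.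
\<close>

lemma exp_half_period:
  assumes "Im r > 0"
  shows "exp (- r * complex_of_real (t + pi / Im r)) =
    - complex_of_real (exp (- Re r * (pi / Im r))) * exp (- r * complex_of_real t)"
proof -
  have "exp (- r * complex_of_real (pi / Im r)) = - complex_of_real (exp (- Re r * (pi / Im r)))"
    using assms by (simp add: complex_eq_iff Re_exp Im_exp)
  moreover have "- r * complex_of_real (t + pi / Im r) = - r * complex_of_real (pi / Im r) + - r * complex_of_real t"
    by (simp add: algebra_simps)
  ultimately show ?thesis
    by (simp only: exp_add)
qed

text \<open>
  Remove the modes other than \<open>s\<close> one after the other by the half-period averages above.  The average
  that removes \<open>r\<close> multiplies the coefficient of \<open>s\<close> by a factor that vanishes only if
  \<open>Re s = Re r\<close> and \<open>Im s\<close> is an odd multiple of \<open>Im r\<close>; as \<open>Im s\<close> is minimal, this would mean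
  \<open>s = r\<close>.  What remains is a single nonnegative mode; as a mode changes sign every half period, it is zero.
\<close>

lemma eventually_nonneg_exp_sum_coeff_zero:
  assumes "finite R" "s \<notin> R" "Im s > 0" "\<forall>r\<in>R. Im s \<le> Im r"
    and "\<forall>t\<ge>T. 0 \<le> Re (\<Sum>r\<in>insert s R. c r * exp (- r * complex_of_real t))"
  shows "c s = 0"
  using assms
proof (induction R arbitrary: c rule: finite_induct)
  case empty
  define u where "u t = c s * exp (- s * complex_of_real t)" for t
  have pos: "0 \<le> Re (u t)" if "t \<ge> T" for t
    using empty that by (simp add: u_def)
  have zero: "Re (u t) = 0" if "t \<ge> T" for t
  proof (rule antisym)
    have "u (t + pi / Im s) = - complex_of_real (exp (- Re s * (pi / Im s))) * u t"
      unfolding u_def exp_half_period[OF empty(2)] by simp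
    then have "Re (u (t + pi / Im s)) = - exp (- Re s * (pi / Im s)) * Re (u t)"
      by (simp del: exp_of_real)
    moreover have "0 \<le> Re (u (t + pi / Im s))"
      using that empty(2) by (intro pos) (simp add: add_increasing2)
    ultimately show "Re (u t) \<le> 0"
      by (simp add: mult_le_0_iff zero_le_mult_iff)
  qed (rule pos[OF that])
  \<comment> \<open>A quarter period turns the real part into a multiple of the imaginary part.\<close>
  have quarter: "exp (- s * complex_of_real (pi / (2 * Im s))) = - \<i> * complex_of_real (exp (- Re s * (pi / (2 * Im s))))"
    using empty(2) by (simp add: complex_eq_iff Re_exp Im_exp)
  have "u (T + pi / (2 * Im s)) = - \<i> * complex_of_real (exp (- Re s * (pi / (2 * Im s)))) * u T"
  proof -
    have "- s * complex_of_real (T + pi / (2 * Im s)) = - s * complex_of_real (pi / (2 * Im s)) + - s * complex_of_real T"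
      by (simp add: algebra_simps)
    then show ?thesis
      unfolding u_def by (simp only: exp_add quarter) (simp only: mult_ac)
  qed
  then have "Re (u (T + pi / (2 * Im s))) = exp (- Re s * (pi / (2 * Im s))) * Im (u T)"
    by (simp del: exp_of_real)
  then have "Im (u T) = 0"
    using zero[of "T + pi / (2 * Im s)"] empty(2) by simp
  then have "u T = 0"
    using zero[of T] by (simp add: complex_eq_iff)
  then show ?case by (simp add: u_def)
next
  case (insert r R)
  have r: "Im r > 0" "Im s \<le> Im r" "r \<noteq> s" using insert.prems by auto
  define d where "d = pi / Im r"
  define w where "w = exp (Re r * d)"
  define c' where "c' p = c p * (1 + complex_of_real w * exp (- p * complex_of_real d))" for p
  have d: "d > 0" using r by (simp add: d_def)
  have c'r: "c' r = 0"
    using exp_half_period[OF r(1), of 0]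
    by (simp add: c'_def d_def w_def del: exp_of_real) (simp add: exp_minus flip: of_real_mult)
  have "0 \<le> Re (\<Sum>p\<in>insert s R. c' p * exp (- p * complex_of_real t))" if t: "t \<ge> T" for t
  proof -
    let ?h = "\<lambda>t. \<Sum>p\<in>insert s (insert r R). c p * exp (- p * complex_of_real t)"
    have shift: "exp (- p * complex_of_real (t + d)) = exp (- p * complex_of_real t) * exp (- p * complex_of_real d)" for p
      by (simp only: of_real_add distrib_left exp_add)
    have "0 \<le> Re (?h t) + w * Re (?h (t + d))"
    proof (intro add_nonneg_nonneg mult_nonneg_nonneg)
      show "0 \<le> Re (?h t)" "0 \<le> Re (?h (t + d))"
        using insert.prems(4)[rule_format, of t] insert.prems(4)[rule_format, of "t + d"] t d by simp_all
    qed (simp add: w_def)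
    also have "\<dots> = Re (?h t + complex_of_real w * ?h (t + d))"
      by simp
    also have "?h t + complex_of_real w * ?h (t + d) =
        (\<Sum>p\<in>insert s (insert r R). c' p * exp (- p * complex_of_real t))"
      unfolding sum_distrib_left sum.distrib[symmetric]
      by (intro sum.cong refl) (simp only: c'_def shift distrib_left distrib_right mult_1_left mult_1_right mult_ac)
    also have "insert s (insert r R) = insert r (insert s R)" by auto
    also have "(\<Sum>p\<in>insert r (insert s R). c' p * exp (- p * complex_of_real t)) =
        (\<Sum>p\<in>insert s R. c' p * exp (- p * complex_of_real t))"
      using insert.hyps insert.prems c'r by (subst sum.insert) auto
    finally show ?thesis .
  qed
  then have "c' s = 0"
    using insert.prems by (intro insert.IH) auto
  moreover have "1 + w * exp (- s * d) \<noteq> 0"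
  proof
    assume "1 + w * exp (- s * d) = 0"
    then have eq: "complex_of_real w * exp (- s * d) = - 1"
      by (simp add: add_eq_0_iff)
    have "exp (Re r * d - Re s * d) = norm (complex_of_real w * exp (- s * d))"
      by (simp add: norm_mult w_def flip: exp_add)
    then have "Re r * d - Re s * d = 0"
      using eq by simp
    then have Re: "Re r = Re s" using d by simp
    have Re_w: "Re (complex_of_real w * exp (- s * d)) = cos (Im s * d)"
      using Re by (simp add: w_def Re_exp mult.assoc[symmetric] flip: exp_add)
    have cos: "cos (Im s * d) = - 1"
      using Re_w unfolding eq by simp
    have "Im s * d \<le> pi"
      using r insert.prems(2) by (simp add: d_def field_simps)
    moreover have "\<not> Im s * d < pi"
      using cos cos_monotone_0_pi[of "Im s * d" pi] insert.prems(2) d by auto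
    ultimately have "Im s = Im r"
      using r by (simp add: d_def field_simps)
    with Re r show False by (simp add: complex_eq_iff)
  qed
  ultimately show ?case by (simp add: c'_def)
qed

text \<open>
  This is where it matters that the poles and zeros of the plant are not real: a real mode
  \<open>exp (- s t)\<close> with positive coefficient would never become negative.
\<close>

lemma nonreal_exp_sum_negative:
  assumes fin: "finite S" and Im: "\<forall>s\<in>S. Im s > 0" and nz: "s0 \<in> S" "c s0 \<noteq> 0"
  shows "\<exists>t>T. Re (\<Sum>s\<in>S. c s * exp (- s * complex_of_real t)) < 0"
proof (rule ccontr)
  assume "\<not> ?thesis"
  then have nonneg: "0 \<le> Re (\<Sum>s\<in>S. c s * exp (- s * complex_of_real t))" if "t > T" for t
    using that by force
  define S' where "S' = {s\<in>S. c s \<noteq> 0}"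
  have S': "finite S'" "S' \<noteq> {}" "S' \<subseteq> S" using fin nz by (auto simp: S'_def)
  define s where "s = arg_min_on Im S'"
  have s: "s \<in> S'" "\<forall>r\<in>S'. Im s \<le> Im r"
    unfolding s_def using S' by (auto intro: arg_min_if_finite(1) arg_min_least)
  have "c s = 0"
  proof (rule eventually_nonneg_exp_sum_coeff_zero[of "S' - {s}" s "T + 1"])
    have "(\<Sum>r\<in>insert s (S' - {s}). c r * exp (- r * complex_of_real t)) =
        (\<Sum>r\<in>S. c r * exp (- r * complex_of_real t))" for t
      using s(1) fin S'(3) by (intro sum.mono_neutral_left) (auto simp: S'_def)
    then show "\<forall>t\<ge>T + 1. 0 \<le> Re (\<Sum>r\<in>insert s (S' - {s}). c r * exp (- r * complex_of_real t))"
      using nonneg by auto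
  qed (use s S' Im in auto)
  with s show False by (simp add: S'_def)
qed

section \<open>Separation in finitely many coordinates\<close>

text \<open>
  The separation of a convex set from the origin in \<open>I \<Rightarrow> real\<close>, where the dimension \<open>card I\<close> is not
  fixed by a type.  One coordinate \<open>k\<close> is treated at a time: if it has constant sign on \<open>K\<close>, it
  separates.  Otherwise a functional \<open>F\<close> that is nonnegative on the slice \<open>x k = 0\<close> extends to
  \<open>F x - m * x k\<close>, where \<open>m\<close> lies between the slopes \<open>F y / y k\<close> with \<open>y k < 0\<close> and \<open>F x / x k\<close>
  with \<open>x k > 0\<close>, as in the proof of the Hahn-Banach theorem.
\<close>

lemma convex_coordinates_separation:
  fixes K :: "('i \<Rightarrow> real) set"
  assumes "finite I" "K \<noteq> {}"
    and "\<And>x y u. x \<in> K \<Longrightarrow> y \<in> K \<Longrightarrow> 0 \<le> u \<Longrightarrow> u \<le> 1 \<Longrightarrow> (\<lambda>i. u * x i + (1 - u) * y i) \<in> K"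
    and "\<And>x. x \<in> K \<Longrightarrow> \<exists>i\<in>I. x i \<noteq> 0"
  shows "\<exists>a. (\<exists>i\<in>I. a i \<noteq> 0) \<and> (\<forall>x\<in>K. 0 \<le> (\<Sum>i\<in>I. a i * x i))"
  using assms
proof (induction I arbitrary: K rule: finite_induct)
  case empty
  then show ?case by fastforce
next
  case (insert k I)
  have conv: "(\<lambda>i. u * x i + (1 - u) * y i) \<in> K" if "x \<in> K" "y \<in> K" "0 \<le> u" "u \<le> 1" for x y u
    using insert.prems(2) that .
  \<comment> \<open>the convex combination of \<open>x\<close> and \<open>y\<close> whose coordinate \<open>k\<close> is zero\<close>
  let ?u = "\<lambda>x y. - y k / (x k - y k)"
  have cross: "(\<lambda>i. ?u x y * x i + (1 - ?u x y) * y i) \<in> {x\<in>K. x k = 0}"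
    if "x \<in> K" "y \<in> K" "x k > 0" "y k < 0" for x y
  proof -
    have "0 \<le> ?u x y" "?u x y \<le> 1"
      using that by (auto simp: divide_simps)
    moreover have "?u x y * x k + (1 - ?u x y) * y k = 0"
      using that by (simp add: field_simps)
    ultimately show ?thesis
      using conv that by blast
  qed
  show ?case
  proof (cases "(\<forall>x\<in>K. x k \<ge> 0) \<or> (\<forall>x\<in>K. x k \<le> 0)")
    case True
    then have "(\<forall>x\<in>K. 1 * x k \<ge> 0) \<or> (\<forall>x\<in>K. - 1 * x k \<ge> 0)"
      by simp
    then obtain b :: real where b: "b \<noteq> 0" "\<forall>x\<in>K. b * x k \<ge> 0"
      by (metis one_neq_zero neg_equal_0_iff_equal)
    have "(\<Sum>i\<in>insert k I. (if i = k then b else 0) * x i) = b * x k" for x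
      using insert.hyps by (simp add: sum.neutral)
    with b show ?thesis
      by (intro exI[of _ "\<lambda>i. if i = k then b else 0"]) auto
  next
    case False
    then obtain x0 y0 where xy0: "x0 \<in> K" "y0 \<in> K" "x0 k > 0" "y0 k < 0"
      by force
    then have ne: "{x\<in>K. x k = 0} \<noteq> {}"
      using cross by blast
    have "\<exists>a. (\<exists>i\<in>I. a i \<noteq> 0) \<and> (\<forall>x\<in>{x\<in>K. x k = 0}. 0 \<le> (\<Sum>i\<in>I. a i * x i))"
    proof (rule insert.IH[OF ne])
      show "(\<lambda>i. u * x i + (1 - u) * y i) \<in> {x\<in>K. x k = 0}"
        if "x \<in> {x\<in>K. x k = 0}" "y \<in> {x\<in>K. x k = 0}" "0 \<le> u" "u \<le> 1" for x y u
        using that conv by simp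
      show "\<exists>i\<in>I. x i \<noteq> 0" if "x \<in> {x\<in>K. x k = 0}" for x
        using that insert.prems(3) by auto
    qed
    then obtain a where a: "\<exists>i\<in>I. a i \<noteq> 0" "\<And>x. x \<in> K \<Longrightarrow> x k = 0 \<Longrightarrow> 0 \<le> (\<Sum>i\<in>I. a i * x i)"
      by blast
    define F where "F x = (\<Sum>i\<in>I. a i * x i)" for x
    have F_conv: "F (\<lambda>i. u * x i + (1 - u) * y i) = u * F x + (1 - u) * F y" for u x y
      by (simp add: F_def sum_distrib_left sum.distrib distrib_left mult.left_commute)
    have slope: "F y / y k \<le> F x / x k" if xy: "x \<in> K" "y \<in> K" "x k > 0" "y k < 0" for x y
    proof -
      let ?z = "\<lambda>i. ?u x y * x i + (1 - ?u x y) * y i"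
      have "0 \<le> F ?z"
        using cross[OF xy] a(2) unfolding F_def by blast
      also have "F ?z = ?u x y * F x + (1 - ?u x y) * F y"
        by (rule F_conv)
      also have "1 - ?u x y = x k / (x k - y k)"
        using xy by (simp add: field_simps)
      finally have "0 \<le> (- y k * F x + x k * F y) / (x k - y k)"
        by (simp only: add_divide_distrib times_divide_eq_left)
      then have "0 \<le> - y k * F x + x k * F y"
        using xy by (simp add: zero_le_divide_iff)
      then show ?thesis
        using xy by (simp add: field_simps)
    qed
    define Y where "Y = (\<lambda>y. F y / y k) ` {y\<in>K. y k < 0}"
    define m where "m = Sup Y"
    have bdd: "bdd_above Y"
      unfolding Y_def bdd_above_def using slope[OF xy0(1) _ xy0(3)] by auto
    have m_le: "m \<le> F x / x k" if "x \<in> K" "x k > 0" for x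
      unfolding m_def using slope that xy0 by (intro cSup_least) (auto simp: Y_def)
    have m_ge: "F y / y k \<le> m" if "y \<in> K" "y k < 0" for y
      unfolding m_def using that bdd by (intro cSup_upper) (auto simp: Y_def)
    show ?thesis
    proof (intro exI[of _ "a(k := - m)"] conjI ballI)
      show "\<exists>i\<in>insert k I. (a(k := - m)) i \<noteq> 0"
        using a(1) insert.hyps by auto
      fix x assume x: "x \<in> K"
      have "(\<Sum>i\<in>insert k I. (a(k := - m)) i * x i) = F x - m * x k"
        using insert.hyps by (simp add: F_def) (intro sum.cong, auto)
      also have "0 \<le> \<dots>"
      proof (cases "x k = 0")
        case True
        then show ?thesis using a(2)[OF x] by (simp add: F_def)
      next
        case False
        then consider "x k > 0" | "x k < 0" by linarith
        then show ?thesis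
          using m_le[OF x] m_ge[OF x] by cases (auto simp: field_simps)
      qed
      finally show "0 \<le> (\<Sum>i\<in>insert k I. (a(k := - m)) i * x i)" .
    qed
  qed
qed

section \<open>Uniform approximation by exponential polynomials\<close>

text \<open>
  Divide \<open>f\<close> by \<open>exp (- t) (1 - exp (- t))\<^sup>m\<close> and approximate the quotient by polynomials in
  \<open>x = exp (- t)\<close> on \<open>[0, 1]\<close>.  The quotient is continuous up to both ends since \<open>f\<close> vanishes
  near infinity and, if \<open>m > 0\<close>, near \<open>0\<close>; the divisor is at most \<open>1\<close>, so multiplying it
  back does not enlarge the error.
\<close>

lemma exp_poly_approximation:
  assumes cont: "continuous_on {0..} f"
    and \<tau>: "0 < \<tau>" and left: "m > 0 \<Longrightarrow> \<forall>t\<in>{0..\<tau>}. f t = 0"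
    and right: "\<forall>t\<ge>T. f t = 0" and e: "e > 0"
  obtains q where "\<And>t. t \<ge> 0 \<Longrightarrow> \<bar>f t - exp_poly m q t\<bar> < e"
proof -
  \<comment> \<open>The truncation at \<open>\<tau>\<close> keeps the divisor away from zero; where it changes the divisor, \<open>f\<close> vanishes or \<open>m = 0\<close>.\<close>
  define v where "v t = exp (- t) * (1 - exp (- max t \<tau>)) ^ m" for t
  have v0: "v t \<noteq> 0" for t
    using \<tau> by (simp add: v_def)
  define G where "G t = f t / v t" for t
  have contG: "continuous_on {0..} G"
    unfolding G_def using v0 by (intro continuous_on_divide cont) (auto simp: v_def intro!: continuous_intros)
  define T' where "T' = max T 0"
  \<comment> \<open>inverts \<open>x = exp (- t)\<close> as far as \<open>T'\<close> and stays constant, where \<open>G\<close> is zero, down to \<open>x = 0\<close>\<close>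
  define L where "L x = - ln (max x (exp (- T')))" for x
  have L0: "0 \<le> L x" if "x \<in> {0..1}" for x
  proof -
    have "0 < max x (exp (- T'))" "max x (exp (- T')) \<le> 1"
      using that by (auto simp: T'_def less_max_iff_disj)
    then show ?thesis by (simp add: L_def)
  qed
  have "continuous_on {0..1} (\<lambda>x. G (L x))"
  proof (rule continuous_on_compose2[OF contG])
    show "continuous_on {0..1} L"
      unfolding L_def by (intro continuous_intros) (auto simp: max_def)
  qed (use L0 in auto)
  then obtain g where g: "real_polynomial_function g" "\<And>x. x \<in> {0..1} \<Longrightarrow> \<bar>G (L x) - g x\<bar> < e"
    using Stone_Weierstrass_real_polynomial_function[of "{0..1::real}" "\<lambda>x. G (L x)" e] e by auto
  from g(1) obtain a n where "g = (\<lambda>x. \<Sum>i\<le>n. a i * x ^ i)"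
    by (auto simp: real_polynomial_function_iff_sum)
  then have g_poly: "g x = poly (\<Sum>i\<le>n. monom (a i) i) x" for x
    by (simp add: poly_sum poly_monom)
  show thesis
  proof (rule that)
    fix t :: real assume t: "t \<ge> 0"
    define x where "x = exp (- t)"
    have x: "x \<in> {0..1}" "0 \<le> x" "x \<le> 1" using t by (auto simp: x_def)
    have "G (L x) = G t"
    proof (cases "t \<le> T'")
      case True
      then show ?thesis by (simp add: L_def x_def max_def)
    next
      case False
      then have "L x = T'" by (simp add: L_def x_def max_def)
      with False show ?thesis
        using right by (simp add: G_def T'_def)
    qed
    then have close: "\<bar>G t - g x\<bar> < e"
      using g(2)[OF x(1)] by simp
    have f: "f t = x * (1 - x) ^ m * G t"
    proof (cases "m > 0 \<and> t \<le> \<tau>")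
      case True
      then show ?thesis using left t by (simp add: G_def)
    next
      case False
      then have "v t = x * (1 - x) ^ m"
        by (auto simp: v_def x_def max_def)
      then show ?thesis using v0[of t] by (simp add: G_def)
    qed
    have "\<bar>f t - exp_poly m (\<Sum>i\<le>n. monom (a i) i) t\<bar> = x * (1 - x) ^ m * \<bar>G t - g x\<bar>"
    proof -
      have "f t - exp_poly m (\<Sum>i\<le>n. monom (a i) i) t = x * (1 - x) ^ m * (G t - g x)"
        unfolding f exp_poly_def g_poly x_def by (simp add: right_diff_distrib)
      then show ?thesis using x by (simp add: abs_mult)
    qed
    also have "\<dots> \<le> 1 * \<bar>G t - g x\<bar>"
      using x by (intro mult_right_mono mult_le_one power_le_one) auto
    finally show "\<bar>f t - exp_poly m (\<Sum>i\<le>n. monom (a i) i) t\<bar> < e"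
      using close by simp
  qed
qed

section \<open>Corrections with prescribed zeros and one-sided bounds\<close>

lemma C0_spaceD:
  assumes "f \<in> C0_space"
  shows "continuous_on {0..} f" "(f \<longlongrightarrow> 0) at_top"
  using assms by (auto simp: C0_space_def)

lemma C0_space_bounded:
  assumes "f \<in> C0_space"
  obtains B where "\<And>t. t \<ge> 0 \<Longrightarrow> \<bar>f t\<bar> \<le> B"
proof -
  note f = C0_spaceD[OF assms]
  have "\<forall>\<^sub>F t in at_top. \<bar>f t\<bar> < 1"
    using tendstoD[OF f(2), of 1] by simp
  then obtain T where T: "\<And>t. t \<ge> T \<Longrightarrow> \<bar>f t\<bar> < 1"
    by (auto simp: eventually_at_top_linorder)
  have "bounded (f ` {0..max T 0})"
    using f(1) by (intro compact_imp_bounded compact_continuous_image) (auto elim: continuous_on_subset)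
  then obtain B where B: "\<forall>t\<in>{0..max T 0}. \<bar>f t\<bar> \<le> B"
    unfolding bounded_iff by auto
  show thesis
  proof (rule that[of "max B 1"])
    show "\<bar>f t\<bar> \<le> max B 1" if "t \<ge> 0" for t
      using B T[of t] that by (cases "t \<le> max T 0") (auto simp: le_max_iff_disj)
  qed
qed

lemma exp_poly_continuous: "continuous_on A (exp_poly m q)"
  unfolding exp_poly_def by (intro continuous_intros)

lemma exp_poly_tendsto_0: "(exp_poly m q \<longlongrightarrow> 0) at_top"
proof -
  have e: "((\<lambda>t::real. exp (- t)) \<longlongrightarrow> 0) at_top" by real_asymp
  have "((\<lambda>t. exp (- t) * (1 - exp (- t)) ^ m * poly q (exp (- t))) \<longlongrightarrow> 0 * (1 - 0) ^ m * poly q 0) at_top"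
    by (intro tendsto_mult tendsto_power tendsto_diff tendsto_const e isCont_tendsto_compose[OF _ e]) simp
  then show ?thesis unfolding exp_poly_def[abs_def] by simp
qed

lemma exp_poly_linear_combination:
  "exp_poly m (smult u p + smult v q) t = u * exp_poly m p t + v * exp_poly m q t"
  by (simp add: exp_poly_def algebra_simps)

lemma continuous_pos_lower_bound:
  fixes f :: "real \<Rightarrow> real"
  assumes "continuous_on {a..b} f" "\<forall>t\<in>{a..b}. f t > 0" "a \<le> b"
  obtains d where "d > 0" "\<forall>t\<in>{a..b}. d \<le> f t"
  using continuous_attains_inf[of "{a..b}" f] assms by fastforce

text \<open>
  The functional is integration against \<open>H t = (\<Sum>s\<in>S. c s * exp (- s t))\<close>, whose real part is
  negative at some \<open>t1\<close> beyond \<open>T\<close>; a narrow tent around \<open>t1\<close> sees only negative values.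
\<close>

lemma laplace_functional_bump_negative:
  fixes c :: "complex \<Rightarrow> complex"
  assumes fin: "finite S" and Re: "\<forall>s\<in>S. Re s > 0" and Im: "\<forall>s\<in>S. Im s > 0"
    and nz: "s0 \<in> S" "c s0 \<noteq> 0" and T: "T \<ge> 0"
  obtains b T' where "continuous_on UNIV b" "\<And>t. 0 \<le> b t" "\<And>t. b t \<le> 1"
    "\<And>t. t \<le> T \<Longrightarrow> b t = 0" "\<And>t. t \<ge> T' \<Longrightarrow> b t = 0"
    "Re (\<Sum>s\<in>S. c s * laplace b s) < 0"
proof -
  define H where "H t = (\<Sum>s\<in>S. c s * exp (- s * complex_of_real t))" for t
  obtain t1 where t1: "t1 > T" "Re (H t1) < 0"
    using nonreal_exp_sum_negative[of S s0 c T] fin Im nz unfolding H_def by blast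
  have "continuous_on UNIV (\<lambda>t. Re (H t))"
    unfolding H_def by (intro continuous_intros)
  then have "isCont (\<lambda>t. Re (H t)) t1"
    by (simp add: continuous_on_eq_continuous_at)
  then have "\<forall>\<^sub>F t in at t1. Re (H t) < Re (H t1) / 2"
    using t1(2) by (intro order_tendstoD(2)[of _ "Re (H t1)"]) (auto simp: isCont_def)
  then obtain d where d: "d > 0" "\<And>t. t \<noteq> t1 \<Longrightarrow> \<bar>t - t1\<bar> < d \<Longrightarrow> Re (H t) < Re (H t1) / 2"
    by (auto simp: eventually_at dist_real_def)
  define r where "r = min d (t1 - T)"
  have r: "r > 0" "r \<le> t1 - T" "r \<le> d" using d t1 by (auto simp: r_def)
  have neg: "Re (H t) \<le> Re (H t1) / 2" if "\<bar>t - t1\<bar> < r" for t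
    using d(2)[of t] that r t1(2) by (cases "t = t1") auto
  define b where "b t = max 0 (1 - \<bar>t - t1\<bar> / r)" for t
  have b_cont: "continuous_on A b" for A
    unfolding b_def using r by (intro continuous_intros) auto
  have b01: "0 \<le> b t" "b t \<le> 1" for t
    using r by (auto simp: b_def)
  have b0: "b t = 0" if "\<bar>t - t1\<bar> \<ge> r" for t
    using that r by (simp add: b_def)
  have int: "set_integrable lborel {0..} (\<lambda>t. c s * (exp (- s * complex_of_real t) * complex_of_real (b t)))"
    if "s \<in> S" for s
    using laplace_bounded(1)[of b 1 s] b_cont b01 Re that by (auto simp: laplace_integrable_def)
  have sum: "(\<Sum>s\<in>S. c s * laplace b s) = (LINT t:{0..}|lborel. H t * complex_of_real (b t))"
  proof -
    have "(\<Sum>s\<in>S. c s * laplace b s) =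
        (\<Sum>s\<in>S. LINT t:{0..}|lborel. c s * (exp (- s * complex_of_real t) * complex_of_real (b t)))"
      by (simp add: laplace_def)
    also have "\<dots> = (LINT t|lborel. (\<Sum>s\<in>S. indicator {0..} t *\<^sub>R (c s * (exp (- s * complex_of_real t) * complex_of_real (b t)))))"
      unfolding set_lebesgue_integral_def
      by (rule Bochner_Integration.integral_sum[symmetric]) (use int in \<open>auto simp: set_integrable_def\<close>)
    finally show ?thesis
      by (simp add: set_lebesgue_integral_def H_def sum_distrib_right scaleR_sum_right mult.assoc)
  qed
  have int_H: "integrable lborel (\<lambda>t. indicator {0..} t *\<^sub>R (H t * complex_of_real (b t)))"
  proof -
    have "integrable lborel (\<lambda>t. \<Sum>s\<in>S. indicator {0..} t *\<^sub>R (c s * (exp (- s * complex_of_real t) * complex_of_real (b t))))"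
      by (rule Bochner_Integration.integrable_sum) (use int in \<open>auto simp: set_integrable_def\<close>)
    then show ?thesis
      by (simp add: H_def sum_distrib_right scaleR_sum_right mult.assoc)
  qed
  let ?J = "{t1 - r / 2 .. t1 + r / 2}"
  have "Re (\<Sum>s\<in>S. c s * laplace b s) = (LINT t|lborel. Re (indicator {0..} t *\<^sub>R (H t * complex_of_real (b t))))"
    unfolding sum set_lebesgue_integral_def by (rule integral_Re[OF int_H, symmetric])
  also have "\<dots> \<le> (LINT t|lborel. indicator ?J t * (Re (H t1) / 4))"
  proof (rule integral_mono)
    show "integrable lborel (\<lambda>t. Re (indicator {0..} t *\<^sub>R (H t * complex_of_real (b t))))"
      by (rule integrable_Re[OF int_H])
    show "integrable lborel (\<lambda>t. indicator ?J t * (Re (H t1) / 4))"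
      by (intro integrable_mult_left integrable_real_indicator) (auto simp: emeasure_lborel_Icc_eq)
    show "Re (indicator {0..} t *\<^sub>R (H t * complex_of_real (b t))) \<le> indicator ?J t * (Re (H t1) / 4)" for t
    proof (cases "\<bar>t - t1\<bar> < r")
      case True
      have "t \<ge> 0" using True r T by linarith
      have "Re (H t) * b t \<le> Re (H t1) / 2 * b t"
        using neg[OF True] b01 by (intro mult_right_mono) auto
      also have "\<dots> \<le> indicator ?J t * (Re (H t1) / 4)"
      proof (cases "t \<in> ?J")
        case True
        then have "\<bar>t - t1\<bar> \<le> r / 2" unfolding atLeastAtMost_iff by linarith
        then have "b t \<ge> 1 / 2"
          using r by (simp add: b_def max_def field_simps)
        then have "Re (H t1) / 2 * b t \<le> Re (H t1) / 2 * (1 / 2)"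
          using t1(2) by (intro mult_left_mono_neg) auto
        then show ?thesis using True by simp
      qed (use t1(2) b01 in \<open>auto simp: mult_nonpos_nonneg\<close>)
      finally show ?thesis using \<open>t \<ge> 0\<close> by simp
    next
      case False
      then have "t \<notin> ?J" using r by auto
      then show ?thesis using b0 False by simp
    qed
  qed
  also have "\<dots> = r * (Re (H t1) / 4)"
    using r by simp
  also have "\<dots> < 0"
    using r t1(2) by (simp add: mult_pos_neg)
  finally show thesis
    using r by (intro that[of b "t1 + r"] b_cont b01 b0) auto
qed

lemma exp_poly_laplace_integrable: "Re s > 0 \<Longrightarrow> laplace_integrable (exp_poly m q) s"
  using exp_poly_rational_transform[of m q] by metis

text \<open>
  The core of the argument.  Let \<open>K\<close> be the convex set of polynomials whose correction meets the two
  inequalities.  If none of them satisfied the finitely many equations \<open>laplace (exp_poly m q) s = 0\<close>,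
  separation would give a nonzero real functional \<open>\<Lambda>\<close>, a combination of the equations, that is
  nonnegative on \<open>K\<close>.  The signal \<open>d = max (- g - e / 2) 0\<close> lifts \<open>g\<close> to \<open>max g (- e / 2)\<close>; it meets
  both inequalities with a margin, and so does \<open>d + M b\<close> for every \<open>M \<ge> 0\<close> and every nonnegative \<open>b\<close>
  supported beyond \<open>tbar\<close>.  Such signals are uniform limits of corrections from \<open>K\<close>, and \<open>\<Lambda>\<close> is
  continuous in the uniform norm because \<open>Re s > 0\<close>.  So \<open>\<Lambda> d + M \<Lambda> b\<close> is bounded below in \<open>M\<close>, which
  contradicts \<open>\<Lambda> b < 0\<close> for a suitable tent \<open>b\<close>.

  For \<open>m > 0\<close> every correction vanishes at \<open>0\<close>.  The condition \<open>g 0 \<ge> 0\<close> makes this harmless: then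
  \<open>d\<close> vanishes near \<open>0\<close>.
\<close>

lemma exp_poly_correction:
  assumes S: "finite S" "\<forall>s\<in>S. Re s > 0" "\<forall>s\<in>S. Im s > 0"
    and g: "g \<in> C0_space" and g0: "m > 0 \<Longrightarrow> g 0 \<ge> 0"
    and tbar: "tbar > 0"
    and phi: "continuous_on {0..tbar} \<phi>m" "continuous_on {0..tbar} \<phi>p"
      "\<forall>t\<in>{0..tbar}. \<phi>m t < g t \<and> g t < \<phi>p t \<and> 0 \<le> \<phi>p t"
    and e: "e > 0"
  obtains q where "\<forall>t\<in>{0..tbar}. \<phi>m t \<le> g t + exp_poly m q t \<and> g t + exp_poly m q t \<le> \<phi>p t"
    and "\<forall>t\<ge>0. - e \<le> g t + exp_poly m q t"
    and "\<forall>s\<in>S. laplace (exp_poly m q) s = 0"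
proof -
  define K where "K = {q. (\<forall>t\<in>{0..tbar}. \<phi>m t \<le> g t + exp_poly m q t \<and> g t + exp_poly m q t \<le> \<phi>p t) \<and>
    (\<forall>t\<ge>0. - e \<le> g t + exp_poly m q t)}"
  define d where "d t = max (- g t - e / 2) 0" for t
  note g_cont = C0_spaceD(1)[OF g]
  have d_cont: "continuous_on {0..} d"
    unfolding d_def by (intro continuous_intros g_cont)
  have gd: "g t + d t = max (g t) (- e / 2)" for t
    by (simp add: d_def max_def)
  have "\<forall>\<^sub>F t in at_top. \<bar>g t\<bar> < e / 2"
    using tendstoD[OF C0_spaceD(2)[OF g], of "e / 2"] e by simp
  then obtain T0 where T0: "\<And>t. t \<ge> T0 \<Longrightarrow> \<bar>g t\<bar> < e / 2"
    by (auto simp: eventually_at_top_linorder)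
  have d_right: "d t = 0" if "t \<ge> T0" for t
    using T0[OF that] by (simp add: d_def)
  obtain \<tau> where \<tau>: "0 < \<tau>" "\<tau> \<le> tbar" "m > 0 \<Longrightarrow> \<forall>t\<in>{0..\<tau>}. d t = 0"
  proof (cases "m > 0")
    case True
    have "\<exists>\<delta>>0. \<forall>t\<in>{0..}. dist t 0 < \<delta> \<longrightarrow> dist (g t) (g 0) < e / 2"
      using g_cont[unfolded continuous_on_iff, rule_format, of 0 "e / 2"] e by simp
    then obtain \<delta> where \<delta>: "\<delta> > 0" "\<And>t. 0 \<le> t \<Longrightarrow> t < \<delta> \<Longrightarrow> \<bar>g t - g 0\<bar> < e / 2"
      by (auto simp: dist_real_def)
    have "d t = 0" if "0 \<le> t" "t < \<delta>" for t
    proof -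
      have "- g t - e / 2 \<le> 0"
        using \<delta>(2)[OF that] g0[OF True] by linarith
      then show ?thesis by (simp add: d_def)
    qed
    then show thesis
      using \<delta>(1) tbar by (intro that[of "min (\<delta> / 2) tbar"]) auto
  qed (use tbar that in auto)
  obtain \<eta>1 where \<eta>1: "\<eta>1 > 0" "\<forall>t\<in>{0..tbar}. \<eta>1 \<le> g t + d t - \<phi>m t"
  proof (rule continuous_pos_lower_bound[of 0 tbar "\<lambda>t. g t + d t - \<phi>m t"])
    show "continuous_on {0..tbar} (\<lambda>t. g t + d t - \<phi>m t)"
      by (intro continuous_intros phi continuous_on_subset[OF g_cont] continuous_on_subset[OF d_cont]) auto
    show "\<forall>t\<in>{0..tbar}. 0 < g t + d t - \<phi>m t"
      using phi(3) unfolding gd by fastforce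
  qed (use tbar in auto)
  obtain \<eta>2 where \<eta>2: "\<eta>2 > 0" "\<forall>t\<in>{0..tbar}. \<eta>2 \<le> \<phi>p t - (g t + d t)"
  proof (rule continuous_pos_lower_bound[of 0 tbar "\<lambda>t. \<phi>p t - (g t + d t)"])
    show "continuous_on {0..tbar} (\<lambda>t. \<phi>p t - (g t + d t))"
      by (intro continuous_intros phi continuous_on_subset[OF g_cont] continuous_on_subset[OF d_cont]) auto
    show "\<forall>t\<in>{0..tbar}. 0 < \<phi>p t - (g t + d t)"
      using phi(3) e unfolding gd by (fastforce simp: max_def)
  qed (use tbar in auto)
  have approx: "\<exists>q\<in>K. \<forall>t\<ge>0. \<bar>d t + b t - exp_poly m q t\<bar> \<le> 1"
    if b: "continuous_on {0..} b" "\<And>t. 0 \<le> b t" "\<And>t. t \<le> tbar \<Longrightarrow> b t = 0" "\<And>t. t \<ge> T1 \<Longrightarrow> b t = 0"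
    for b T1
  proof -
    define \<delta> where "\<delta> = min (min \<eta>1 \<eta>2) (min (e / 2) 1)"
    have \<delta>: "\<delta> > 0" "\<delta> \<le> \<eta>1" "\<delta> \<le> \<eta>2" "\<delta> \<le> e / 2" "\<delta> \<le> 1"
      using \<eta>1 \<eta>2 e by (auto simp: \<delta>_def)
    obtain q where q: "\<And>t. t \<ge> 0 \<Longrightarrow> \<bar>d t + b t - exp_poly m q t\<bar> < \<delta>"
    proof (rule exp_poly_approximation[of "\<lambda>t. d t + b t" \<tau> m "max T0 T1" \<delta>])
      show "continuous_on {0..} (\<lambda>t. d t + b t)"
        by (intro continuous_intros d_cont b)
      show "\<forall>t\<ge>max T0 T1. d t + b t = 0"
        using d_right b(4) by auto
      show "\<forall>t\<in>{0..\<tau>}. d t + b t = 0" if "m > 0"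
        using \<tau> that b(3) by auto
    qed (use \<tau> \<delta> in auto)
    have "q \<in> K"
      unfolding K_def
    proof (intro CollectI conjI ballI allI impI)
      fix t assume t: "t \<in> {0..tbar}"
      then show "\<phi>m t \<le> g t + exp_poly m q t" "g t + exp_poly m q t \<le> \<phi>p t"
        using q[of t] b(3)[of t] \<eta>1(2)[rule_format, OF t] \<eta>2(2)[rule_format, OF t] \<delta> by auto
    next
      fix t :: real assume t: "t \<ge> 0"
      have "- e / 2 \<le> g t + d t" unfolding gd by simp
      then show "- e \<le> g t + exp_poly m q t"
        using q[OF t] b(2)[of t] \<delta> by auto
    qed
    moreover have "\<bar>d t + b t - exp_poly m q t\<bar> \<le> 1" if "t \<ge> 0" for t
      using q[OF that] \<delta>(5) by linarith
    ultimately show ?thesis by blast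
  qed
  have "\<exists>q\<in>K. \<forall>s\<in>S. laplace (exp_poly m q) s = 0"
  proof (rule ccontr)
    assume none: "\<not> ?thesis"
    \<comment> \<open>The value \<open>0\<close> at the remaining indices makes \<open>X\<close> affine as a function on the whole index type.\<close>
    define X where "X q = (\<lambda>(s, b). if Re s > 0 then
      (if b then Re (laplace (exp_poly m q) s) else Im (laplace (exp_poly m q) s)) else 0)" for q
    have "\<exists>a. (\<exists>i\<in>S \<times> UNIV. a i \<noteq> 0) \<and> (\<forall>x\<in>X ` K. 0 \<le> (\<Sum>i\<in>S \<times> UNIV. a i * x i))"
    proof (rule convex_coordinates_separation)
      show "finite (S \<times> (UNIV :: bool set))" using S by simp
      show "X ` K \<noteq> {}" using approx[of "\<lambda>_. 0"] by auto
    next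
      fix x y :: "complex \<times> bool \<Rightarrow> real" and u :: real
      assume xy: "x \<in> X ` K" "y \<in> X ` K" and u: "0 \<le> u" "u \<le> 1"
      from xy obtain p q where pq: "p \<in> K" "q \<in> K" "x = X p" "y = X q" by auto
      let ?r = "smult u p + smult (1 - u) q"
      have r: "g t + exp_poly m ?r t = u * (g t + exp_poly m p t) + (1 - u) * (g t + exp_poly m q t)" for t
        by (simp add: exp_poly_linear_combination algebra_simps)
      have conv_ge: "c \<le> u * a + (1 - u) * b" if "c \<le> a" "c \<le> b" for a b c :: real
        using convex_bound_le[of "- a" "- c" "- b" u "1 - u"] that u by simp
      have conv_le: "u * a + (1 - u) * b \<le> c" if "a \<le> c" "b \<le> c" for a b c :: real
        using convex_bound_le[of a c b u "1 - u"] that u by simp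
      have "?r \<in> K"
        using pq(1,2) unfolding K_def mem_Collect_eq r by (auto intro!: conv_ge conv_le)
      moreover have "X ?r = (\<lambda>i. u * x i + (1 - u) * y i)"
      proof (rule ext, clarify)
        fix s b
        have "laplace (exp_poly m ?r) s = u * laplace (exp_poly m p) s + (1 - u) * laplace (exp_poly m q) s" if "Re s > 0"
        proof -
          have "exp_poly m ?r = (\<lambda>t. u * exp_poly m p t + (1 - u) * exp_poly m q t)"
            by (rule ext) (rule exp_poly_linear_combination)
          then show ?thesis
            using that by (simp add: laplace_add laplace_cmult exp_poly_laplace_integrable)
        qed
        then show "X ?r (s, b) = u * x (s, b) + (1 - u) * y (s, b)"
          unfolding pq(3,4) by (simp add: X_def)
      qed
      ultimately show "(\<lambda>i. u * x i + (1 - u) * y i) \<in> X ` K"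
        by (metis image_eqI)
    next
      fix x assume "x \<in> X ` K"
      then obtain q where q: "q \<in> K" "x = X q" by auto
      then obtain s where s: "s \<in> S" "laplace (exp_poly m q) s \<noteq> 0" using none by auto
      then have "x (s, True) \<noteq> 0 \<or> x (s, False) \<noteq> 0"
        using S(2) q(2) by (auto simp: X_def complex_eq_iff)
      with s(1) show "\<exists>i\<in>S \<times> UNIV. x i \<noteq> 0" by blast
    qed
    then obtain a where a: "\<exists>i\<in>S \<times> UNIV. a i \<noteq> 0"
      "\<And>q. q \<in> K \<Longrightarrow> 0 \<le> (\<Sum>i\<in>S \<times> UNIV. a i * X q i)"
      by blast
    \<comment> \<open>complex weights, so that \<open>Re (c s * z)\<close> is the combination of \<open>Re z\<close> and \<open>Im z\<close> with weights \<open>a\<close>\<close>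
    define c where "c s = Complex (a (s, True)) (- a (s, False))" for s
    define \<Lambda> where "\<Lambda> f = Re (\<Sum>s\<in>S. c s * laplace f s)" for f
    have \<Lambda>_K: "0 \<le> \<Lambda> (exp_poly m q)" if "q \<in> K" for q
    proof -
      have "(\<Sum>i\<in>S \<times> UNIV. a i * X q i) = (\<Sum>s\<in>S. \<Sum>b\<in>UNIV. a (s, b) * X q (s, b))"
        by (simp add: sum.cartesian_product)
      also have "\<dots> = \<Lambda> (exp_poly m q)"
        using S(2) by (simp add: \<Lambda>_def UNIV_bool X_def c_def add.commute)
      finally show ?thesis using a(2)[OF that] by simp
    qed
    from a(1) obtain s0 where s0: "s0 \<in> S" "c s0 \<noteq> 0"
      by (auto simp: c_def complex_eq_iff) (metis (full_types))
    obtain b T1 where b: "continuous_on UNIV b" "\<And>t. 0 \<le> b t" "\<And>t. b t \<le> 1"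
      "\<And>t. t \<le> tbar \<Longrightarrow> b t = 0" "\<And>t. t \<ge> T1 \<Longrightarrow> b t = 0" "\<Lambda> b < 0"
      unfolding \<Lambda>_def
      by (rule laplace_functional_bump_negative[of S s0 c tbar]) (use S s0 tbar in auto)
    have b_int: "laplace_integrable b s" if "Re s > 0" for s
      using laplace_bounded(1)[of b 1 s] b that continuous_on_subset[OF b(1)] by auto
    obtain B where B: "\<And>t. t \<ge> 0 \<Longrightarrow> \<bar>g t\<bar> \<le> B" using C0_space_bounded[OF g] by blast
    have d_int: "laplace_integrable d s" if "Re s > 0" for s
    proof (rule laplace_bounded(1)[OF d_cont _ that])
      show "\<bar>d t\<bar> \<le> B" if "t \<ge> 0" for t
        using B[OF that] e by (auto simp: d_def max_def)
    qed
    define C where "C = (\<Sum>s\<in>S. norm (c s) * (1 / Re s))"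
    \<comment> \<open>large enough to push \<open>\<Lambda> (d + M b)\<close> below \<open>- C\<close>, while \<open>\<Lambda>\<close> changes by at most \<open>C\<close> in the approximation\<close>
    define M where "M = (\<bar>\<Lambda> d\<bar> + \<bar>C\<bar> + 1) / (- \<Lambda> b)"
    have M: "M \<ge> 0" "M * \<Lambda> b = - (\<bar>\<Lambda> d\<bar> + \<bar>C\<bar> + 1)"
      using b(6) by (auto simp: M_def field_simps)
    define f where "f t = d t + M * b t" for t
    have f_int: "laplace_integrable f s" and f_lap: "laplace f s = laplace d s + M * laplace b s"
      if "Re s > 0" for s
      unfolding f_def
      by (simp_all add: laplace_add laplace_cmult d_int[OF that] b_int[OF that])
    have \<Lambda>f: "\<Lambda> f = \<Lambda> d + M * \<Lambda> b"
    proof -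
      have "(\<Sum>s\<in>S. c s * laplace f s) = (\<Sum>s\<in>S. c s * laplace d s) + M * (\<Sum>s\<in>S. c s * laplace b s)"
        unfolding sum_distrib_left sum.distrib[symmetric]
        using S(2) by (intro sum.cong) (simp_all add: f_lap algebra_simps)
      then show ?thesis by (simp add: \<Lambda>_def)
    qed
    have "\<exists>q\<in>K. \<forall>t\<ge>0. \<bar>d t + M * b t - exp_poly m q t\<bar> \<le> 1"
    proof (rule approx[of _ T1])
      show "continuous_on {0..} (\<lambda>t. M * b t)"
        by (intro continuous_intros continuous_on_subset[OF b(1)]) auto
    qed (use b M(1) in auto)
    then obtain q where q: "q \<in> K" "\<And>t. t \<ge> 0 \<Longrightarrow> \<bar>f t - exp_poly m q t\<bar> \<le> 1"
      unfolding f_def by blast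
    have f_cont: "continuous_on {0..} f"
      unfolding f_def by (intro continuous_intros d_cont continuous_on_subset[OF b(1)]) auto
    have "\<Lambda> (exp_poly m q) - \<Lambda> f \<le> C"
    proof -
      have "\<Lambda> (exp_poly m q) - \<Lambda> f = Re (\<Sum>s\<in>S. c s * (laplace (exp_poly m q) s - laplace f s))"
        by (simp add: \<Lambda>_def right_diff_distrib sum_subtractf)
      also have "\<dots> \<le> norm (\<Sum>s\<in>S. c s * (laplace (exp_poly m q) s - laplace f s))"
        by (rule complex_Re_le_cmod)
      also have "\<dots> \<le> C"
        unfolding C_def
      proof (rule sum_norm_le)
        fix s assume s: "s \<in> S"
        then have Re: "Re s > 0" using S(2) by auto
        have "norm (laplace (\<lambda>t. exp_poly m q t - f t) s) \<le> 1 / Re s"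
        proof (rule laplace_bounded(2)[OF _ _ Re])
          show "continuous_on {0..} (\<lambda>t. exp_poly m q t - f t)"
            by (intro continuous_intros f_cont exp_poly_continuous)
          show "\<bar>exp_poly m q t - f t\<bar> \<le> 1" if "t \<ge> 0" for t
            using q(2)[OF that] by linarith
        qed
        then show "norm (c s * (laplace (exp_poly m q) s - laplace f s)) \<le> norm (c s) * (1 / Re s)"
          using laplace_diff(2)[OF exp_poly_laplace_integrable[OF Re] f_int[OF Re]]
          unfolding norm_mult by (intro mult_left_mono) auto
      qed
      finally show ?thesis .
    qed
    with \<Lambda>f M(2) \<Lambda>_K[OF q(1)] show False by linarith
  qed
  then show thesis
    using that unfolding K_def by blast
qed

section \<open>Feasible error signals\<close>

lemma laplace_cnj: "laplace f (cnj s) = cnj (laplace f s)"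
proof -
  have "laplace f (cnj s) = (LINT t|lborel. cnj (indicator {0..} t *\<^sub>R (exp (- s * complex_of_real t) * complex_of_real (f t))))"
    unfolding laplace_def set_lebesgue_integral_def
    by (intro Bochner_Integration.integral_cong refl) (simp add: exp_cnj)
  then show ?thesis
    unfolding laplace_def set_lebesgue_integral_def by (simp only: Bochner_Integration.integral_cnj)
qed

lemma has_rational_laplace_iff:
  "has_rational_laplace f F \<longleftrightarrow>
    (\<exists>\<sigma>. \<forall>s. Re s > \<sigma> \<longrightarrow> laplace_integrable f s \<and> laplace f s = rat_eval F s)"
  by (simp add: has_rational_laplace_def laplace_integrable_def)

lemma has_rational_laplace_add:
  assumes "has_rational_laplace f A" "has_rational_laplace g B"
  shows "has_rational_laplace (\<lambda>t. f t + g t) (A + B)"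
proof -
  obtain \<sigma>1 \<sigma>2 where f: "\<And>s. Re s > \<sigma>1 \<Longrightarrow> laplace_integrable f s \<and> laplace f s = rat_eval A s"
    and g: "\<And>s. Re s > \<sigma>2 \<Longrightarrow> laplace_integrable g s \<and> laplace g s = rat_eval B s"
    using assms unfolding has_rational_laplace_iff by blast
  obtain a b where "\<And>s. Re s > a \<Longrightarrow> poly (rat_den A) s \<noteq> 0" "\<And>s. Re s > b \<Longrightarrow> poly (rat_den B) s \<noteq> 0"
    using eventually_rat_den_nonzero by blast
  then show ?thesis
    unfolding has_rational_laplace_iff using f g
    by (intro exI[of _ "max (max \<sigma>1 \<sigma>2) (max a b)"]) (simp add: laplace_add rat_eval_add)
qed

lemma has_rational_laplace_uminus:
  assumes "has_rational_laplace f A"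
  shows "has_rational_laplace (\<lambda>t. - f t) (- A)"
proof -
  obtain \<sigma> where f: "\<And>s. Re s > \<sigma> \<Longrightarrow> laplace_integrable f s \<and> laplace f s = rat_eval A s"
    using assms unfolding has_rational_laplace_iff by blast
  obtain a where "\<And>s. Re s > a \<Longrightarrow> poly (rat_den A) s \<noteq> 0"
    using eventually_rat_den_nonzero by blast
  then show ?thesis
    unfolding has_rational_laplace_iff using f laplace_cmult[of f _ "- 1"]
    by (intro exI[of _ "max \<sigma> a"]) (simp add: rat_eval_uminus)
qed

text \<open>
  A zero of order two at infinity makes \<open>x F(x)\<close> tend to \<open>0\<close>.  Applied to the difference of an error
  signal and the reference, this forces both to start at the same value.
\<close>

lemma initial_value_order_two:
  assumes f: "has_rational_laplace f F" and F: "zero_order_inf_ge F 2"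
    and lim: "(f \<longlongrightarrow> l) (at_right 0)"
  shows "l = 0"
proof -
  obtain \<sigma> where \<sigma>: "\<And>s. Re s > \<sigma> \<Longrightarrow> laplace_integrable f s \<and> laplace f s = rat_eval F s"
    using f unfolding has_rational_laplace_iff by blast
  have "((\<lambda>x. complex_of_real x * laplace f (complex_of_real x)) \<longlongrightarrow> complex_of_real l) at_top"
    using lim \<sigma> by (intro initial_value_theorem) auto
  moreover have "\<forall>\<^sub>F x in at_top. complex_of_real x * laplace f (complex_of_real x) =
      complex_of_real x * rat_eval F (complex_of_real x)"
    using eventually_gt_at_top[of \<sigma>] by eventually_elim (simp add: \<sigma>)
  ultimately have "((\<lambda>x. complex_of_real x * rat_eval F (complex_of_real x)) \<longlongrightarrow> complex_of_real l) at_top"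
    by (simp add: filterlim_cong[OF refl refl])
  from tendsto_unique[OF _ this rat_eval_order_two_tendsto_0[OF F]] show ?thesis
    by simp
qed

lemma OS_nonneg:
  assumes "e \<in> C0_space"
  shows "0 \<le> OS e"
proof -
  obtain B where B: "\<And>t. t \<ge> 0 \<Longrightarrow> \<bar>e t\<bar> \<le> B" using C0_space_bounded[OF assms] by blast
  have "bdd_above ((\<lambda>t. max (- e t) 0) ` {0..})"
    using B by (intro bdd_aboveI2[of _ _ B]) (fastforce simp: abs_le_iff)
  then have "max (- e 0) 0 \<le> OS e"
    unfolding OS_def by (intro cSUP_upper) auto
  then show ?thesis by simp
qed

lemma OS_le:
  assumes "\<forall>t\<ge>0. - \<epsilon> \<le> e t" "\<epsilon> \<ge> 0"
  shows "OS e \<le> \<epsilon>"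
  unfolding OS_def using assms by (intro cSUP_least) (fastforce)+

text \<open>
  A correction of order \<open>\<theta>p + \<theta>w\<close> at infinity respects both order conditions, and its vanishing at
  the zeros and poles of \<open>P\<close> respects the interpolation conditions.  At a zero \<open>z\<close> the value \<open>W(z)\<close> is
  nonzero because \<open>W\<close> is minimum-phase; so the transform of \<open>f\<close>, which takes this value, is regular
  at \<open>z\<close>, and values may be added there.
\<close>

lemma M_space_add_exp_poly:
  assumes f: "f \<in> M_space P W \<theta>w \<theta>p" and W: "minimum_phase W"
    and m: "Suc m = \<theta>p + \<theta>w"
    and right: "\<forall>s\<in>crhp_zeros P \<union> crhp_poles P. Re s > 0"
    and q: "\<forall>s\<in>crhp_zeros P \<union> crhp_poles P. laplace (exp_poly m q) s = 0"
  shows "(\<lambda>t. f t + exp_poly m q t) \<in> M_space P W \<theta>w \<theta>p"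
proof -
  obtain D where D: "zero_order_inf_ge D (Suc m)"
    "\<And>s. Re s > 0 \<Longrightarrow> poly (rat_den D) s \<noteq> 0"
    "\<And>s. Re s > 0 \<Longrightarrow> laplace_integrable (exp_poly m q) s"
    "\<And>s. Re s > 0 \<Longrightarrow> laplace (exp_poly m q) s = rat_eval D s"
    using exp_poly_rational_transform[of m q] by blast
  have D_lap: "has_rational_laplace (exp_poly m q) D"
    unfolding has_rational_laplace_iff using D(3,4) by blast
  have D0: "poly (rat_den D) s \<noteq> 0" "rat_eval D s = 0" if "s \<in> crhp_zeros P \<union> crhp_poles P" for s
  proof -
    have "Re s > 0" using right that by blast
    then show "poly (rat_den D) s \<noteq> 0" "rat_eval D s = 0"
      using D(2,4)[of s] bspec[OF q that] by simp_all
  qed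
  obtain E where E: "has_rational_laplace f E" "zero_order_inf_ge E \<theta>w" "zero_order_inf_ge (E - W) (\<theta>p + \<theta>w)"
    and C0: "f \<in> C0_space"
    using f unfolding M_space_def X_space_def by blast
  obtain F where F: "has_rational_laplace f F"
    "\<And>z. z \<in> crhp_zeros P \<Longrightarrow> poly (rat_den W) z \<noteq> 0"
    "\<And>z. z \<in> crhp_zeros P \<Longrightarrow> rat_eval F z = rat_eval W z"
    "\<And>p. p \<in> crhp_poles P \<Longrightarrow> rat_eval F p = 0"
    using f unfolding M_space_def by blast
  have "(\<lambda>t. f t + exp_poly m q t) \<in> C0_space"
    using C0_spaceD[OF C0] tendsto_add[OF C0_spaceD(2)[OF C0] exp_poly_tendsto_0[of m q]]
    by (auto simp: C0_space_def intro!: continuous_intros exp_poly_continuous)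
  moreover have "zero_order_inf_ge (E + D) \<theta>w"
    by (rule zero_order_inf_ge_add[OF E(2) zero_order_inf_ge_mono[OF D(1)]]) (simp add: m)
  moreover have "zero_order_inf_ge (E + D - W) (\<theta>p + \<theta>w)"
  proof -
    have "E + D - W = (E - W) + D" by (simp add: algebra_simps)
    then show ?thesis
      using zero_order_inf_ge_add[OF E(3), of D] D(1) by (simp only: m)
  qed
  ultimately have "(\<lambda>t. f t + exp_poly m q t) \<in> X_space W \<theta>w \<theta>p"
    unfolding X_space_def using has_rational_laplace_add[OF E(1) D_lap] by blast
  moreover have "rat_eval (F + D) z = rat_eval W z" if z: "z \<in> crhp_zeros P" for z
  proof -
    have "Re z > 0" using right z by blast
    then have "rat_eval W z \<noteq> 0"
      using W F(2)[OF z] by (simp add: rat_eval_def minimum_phase_def)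
    then have "poly (rat_den F) z \<noteq> 0"
      using F(3)[OF z] by (auto simp: rat_eval_def)
    then show ?thesis
      using F(3)[OF z] D0[of z] z by (simp add: rat_eval_add)
  qed
  moreover have "rat_eval (F + D) p = 0" if "p \<in> crhp_poles P" for p
    using that D0 F(4) by (intro rat_eval_add_zero) auto
  ultimately show ?thesis
    unfolding M_space_def using has_rational_laplace_add[OF F(1) D_lap] F(2) by blast
qed

text \<open>
  Corrections are real, so their transforms take conjugate values at conjugate points, and it suffices
  to impose the equations on representatives in the upper half-plane.  The representatives have to
  be chosen this way: with both members of a conjugate pair in \<open>S\<close>, a nonzero choice of weights could
  give the zero functional.
\<close>

theorem proposition4p7:
  fixes P :: "real poly fract" and W :: "complex poly fract"
    and w \<phi>m \<phi>p ebar :: "real \<Rightarrow> real"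
    and \<theta>p \<theta>w :: nat and tbar :: real
  assumes P_order: "zero_order_inf P \<theta>p"
    and w_laplace: "has_rational_laplace w W"
    and W_order: "zero_order_inf W \<theta>w" "\<theta>w \<ge> 1"
    and no_imag_axis: "\<forall>s\<in>crhp_zeros P \<union> crhp_poles P. Re s \<noteq> 0"
    and simple_zeros: "\<forall>z\<in>crhp_zeros P. order z (map_poly complex_of_real (rat_num P)) = 1"
    and simple_poles: "\<forall>p\<in>crhp_poles P. order p (map_poly complex_of_real (rat_den P)) = 1"
    and distinct: "crhp_zeros P \<inter> crhp_poles P = {}"
    and min_phase: "minimum_phase W"
    and non_real: "\<forall>s\<in>crhp_zeros P \<union> crhp_poles P. Im s \<noteq> 0"
    and tbar_pos: "tbar > 0"
    and phi_cont: "continuous_on {0..tbar} \<phi>m" "continuous_on {0..tbar} \<phi>p"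
    and phi_less: "\<forall>t\<in>{0..tbar}. \<phi>m t < \<phi>p t \<and> \<phi>p t \<ge> 0"
    and ebar_feasible: "ebar \<in> M_space P W \<theta>w \<theta>p"
    and ebar_strict: "\<forall>t\<in>{0..tbar}. \<phi>m t < ebar t \<and> ebar t < \<phi>p t"
    and w_init: "\<theta>w + \<theta>p > 1 \<longrightarrow> (\<exists>w0\<ge>0. (w \<longlongrightarrow> w0) (at_right 0))"
  shows "(INF e \<in> T_space \<phi>m \<phi>p tbar \<inter> M_space P W \<theta>w \<theta>p. OS e) = 0"
proof -
  define m where "m = \<theta>p + \<theta>w - 1"
  have m: "Suc m = \<theta>p + \<theta>w" using W_order(2) by (simp add: m_def)
  define Z where "Z = crhp_zeros P \<union> crhp_poles P"
  have P0: "P \<noteq> 0" using P_order by (simp add: zero_order_inf_def)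
  have finZ: "finite Z"
    unfolding Z_def crhp_zeros_def crhp_poles_def
    using poly_roots_finite[of "cpoly (rat_num P)"] poly_roots_finite[of "cpoly (rat_den P)"] P0
    by (auto simp: map_poly_eq_0_iff)
  have ReZ: "Re s > 0" if "s \<in> Z" for s
    using that no_imag_axis by (force simp: Z_def crhp_zeros_def crhp_poles_def)
  define S where "S = {s. Im s > 0 \<and> (s \<in> Z \<or> cnj s \<in> Z)}"
  have "S \<subseteq> Z \<union> cnj ` Z"
    by (auto simp: S_def image_iff) (metis complex_cnj_cnj)
  then have S: "finite S" "\<forall>s\<in>S. Re s > 0" "\<forall>s\<in>S. Im s > 0"
    using finZ ReZ by (auto simp: S_def intro: finite_subset)
  have ebar_C0: "ebar \<in> C0_space"
    using ebar_feasible by (auto simp: M_space_def X_space_def)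
  \<comment> \<open>For \<open>m > 0\<close>, that is \<open>\<theta>w + \<theta>p > 1\<close>, the error starts at the initial value of the reference.\<close>
  have ebar_0: "ebar 0 \<ge> 0" if "m > 0"
  proof -
    have order: "\<theta>p + \<theta>w \<ge> 2" using that m by simp
    then obtain w0 where w0: "w0 \<ge> 0" "(w \<longlongrightarrow> w0) (at_right 0)"
      using w_init by (auto simp: add.commute)
    obtain E where E: "has_rational_laplace ebar E" "zero_order_inf_ge (E - W) (\<theta>p + \<theta>w)"
      using ebar_feasible by (auto simp: M_space_def X_space_def)
    have "(ebar \<longlongrightarrow> ebar 0) (at 0 within {0..})"
      using C0_spaceD(1)[OF ebar_C0] by (simp add: continuous_on_def)
    then have "(ebar \<longlongrightarrow> ebar 0) (at_right 0)"
      by (rule tendsto_within_subset) auto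
    then have "((\<lambda>t. ebar t + - w t) \<longlongrightarrow> ebar 0 + - w0) (at_right 0)"
      by (intro tendsto_intros w0)
    moreover have "has_rational_laplace (\<lambda>t. ebar t + - w t) (E + - W)"
      by (intro has_rational_laplace_add has_rational_laplace_uminus E w_laplace)
    moreover have "zero_order_inf_ge (E + - W) 2"
      using zero_order_inf_ge_mono[OF E(2) order] by simp
    ultimately have "ebar 0 + - w0 = 0"
      by (intro initial_value_order_two)
    with w0(1) show ?thesis by simp
  qed
  let ?F = "T_space \<phi>m \<phi>p tbar \<inter> M_space P W \<theta>w \<theta>p"
  have small: "\<exists>e\<in>?F. OS e \<le> \<epsilon>" if \<epsilon>: "\<epsilon> > 0" for \<epsilon>
  proof -
    obtain q where q: "\<forall>t\<in>{0..tbar}. \<phi>m t \<le> ebar t + exp_poly m q t \<and> ebar t + exp_poly m q t \<le> \<phi>p t"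
      "\<forall>t\<ge>0. - \<epsilon> \<le> ebar t + exp_poly m q t" "\<forall>s\<in>S. laplace (exp_poly m q) s = 0"
      by (rule exp_poly_correction[of S ebar m tbar \<phi>m \<phi>p \<epsilon>])
        (use S ebar_C0 ebar_0 tbar_pos phi_cont phi_less ebar_strict \<epsilon> in auto)
    have "laplace (exp_poly m q) s = 0" if s: "s \<in> Z" for s
    proof (cases "Im s > 0")
      case True
      then show ?thesis using q(3) s by (auto simp: S_def)
    next
      case False
      then have "cnj s \<in> S" using s non_real by (force simp: S_def Z_def)
      then show ?thesis using q(3) laplace_cnj[of "exp_poly m q" s] by simp
    qed
    then have M: "(\<lambda>t. ebar t + exp_poly m q t) \<in> M_space P W \<theta>w \<theta>p"
      using ReZ by (intro M_space_add_exp_poly ebar_feasible min_phase m) (auto simp: Z_def)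
    then have "(\<lambda>t. ebar t + exp_poly m q t) \<in> T_space \<phi>m \<phi>p tbar"
      using q(1) by (auto simp: T_space_def M_space_def X_space_def)
    with M show ?thesis
      using OS_le[OF q(2)] \<epsilon> by (intro bexI[of _ "\<lambda>t. ebar t + exp_poly m q t"]) auto
  qed
  have nonneg: "0 \<le> OS e" if "e \<in> ?F" for e
    using that by (intro OS_nonneg) (auto simp: T_space_def)
  show ?thesis
  proof (rule antisym)
    show "(INF e \<in> ?F. OS e) \<le> 0"
    proof (rule field_le_epsilon)
      fix \<epsilon> :: real assume "\<epsilon> > 0"
      then obtain e where e: "e \<in> ?F" "OS e \<le> \<epsilon>" using small by blast
      have "bdd_below (OS ` ?F)" using nonneg by (intro bdd_belowI2[of _ 0])
      then have "(INF e \<in> ?F. OS e) \<le> OS e" using e(1) by (rule cINF_lower)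
      then show "(INF e \<in> ?F. OS e) \<le> 0 + \<epsilon>" using e(2) by simp
    qed
    show "0 \<le> (INF e \<in> ?F. OS e)"
      using small[of 1] nonneg by (intro cINF_greatest) auto
  qed
qed

end
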